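(* Let $n\ge 3$ be an integer and let $G$ be a connected simple graph with $n$ vertices and $m$ edges. Then \[ h(G)\;\le\;3n-6-\sqrt{2m}+\sqrt{6(n-2)}. \]
   Context: A drawing of a graph $G$ in the plane represents vertices by distinct points and each edge by a simple continuous arc joining its endpoints, passing through no other vertex; any two edges share finitely many points, no two edges touch at an interior point, and no three edges share a common interior point. An edge is uncrossed in a drawing if it shares no interior point (crossing) with any other edge. The maximum uncrossed subgraph number $h(G)$ is the maximum, over all drawings of $G$ in the plane, of the number of uncrossed edges. *)

theory Defs
  imports "HOL-Analysis.Analysis"
begin

definition simple_graph :: "'a set \<Rightarrow> 'a set set \<Rightarrow> bool" where
  "simple_graph V E \<longleftrightarrow> finite V \<and> (\<forall>e\<in>E. e \<subseteq> V \<and> card e = 2)"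

definition connected_graph :: "'a set \<Rightarrow> 'a set set \<Rightarrow> bool" where
  "connected_graph V E \<longleftrightarrow> V \<noteq> {} \<and> (\<forall>u\<in>V. \<forall>v\<in>V. (u, v) \<in> {(x, y). {x, y} \<in> E}\<^sup>*)"

definition arc_interior :: "(real \<Rightarrow> complex) \<Rightarrow> complex set" where
  "arc_interior g = path_image g - {pathstart g, pathfinish g}"

text \<open>
  Two arcs cross at \<open>x\<close> if, near \<open>x\<close> and up to homeomorphism, they look like the two
  coordinate axes near the origin. A common interior point at which they do not cross
  is one at which they touch.
\<close>

definition crosses_at :: "(real \<Rightarrow> complex) \<Rightarrow> (real \<Rightarrow> complex) \<Rightarrow> complex \<Rightarrow> bool" where
  "crosses_at g1 g2 x \<longleftrightarrow>
    (\<exists>U h k. open U \<and> x \<in> U \<and> homeomorphism U (ball 0 1) h k \<and> h x = 0 \<and>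
      h ` (U \<inter> path_image g1) = {z \<in> ball 0 1. Im z = 0} \<and>
      h ` (U \<inter> path_image g2) = {z \<in> ball 0 1. Re z = 0})"

definition touches_at :: "(real \<Rightarrow> complex) \<Rightarrow> (real \<Rightarrow> complex) \<Rightarrow> complex \<Rightarrow> bool" where
  "touches_at g1 g2 x \<longleftrightarrow> x \<in> arc_interior g1 \<inter> arc_interior g2 \<and> \<not> crosses_at g1 g2 x"

text \<open>
  In a drawing, \<open>p\<close> places the vertices in the plane and \<open>\<gamma> e\<close> parametrises the arc
  of the edge \<open>e\<close>, in either direction.
\<close>

definition drawing ::
  "'a set \<Rightarrow> 'a set set \<Rightarrow> ('a \<Rightarrow> complex) \<Rightarrow> ('a set \<Rightarrow> real \<Rightarrow> complex) \<Rightarrow> bool" where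
  "drawing V E p \<gamma> \<longleftrightarrow>
    inj_on p V \<and>
    (\<forall>e\<in>E. arc (\<gamma> e) \<and> {pathstart (\<gamma> e), pathfinish (\<gamma> e)} = p ` e \<and>
            path_image (\<gamma> e) \<inter> p ` (V - e) = {}) \<and>
    (\<forall>e\<in>E. \<forall>f\<in>E. e \<noteq> f \<longrightarrow>
       finite (path_image (\<gamma> e) \<inter> path_image (\<gamma> f)) \<and>
       (\<forall>x. \<not> touches_at (\<gamma> e) (\<gamma> f) x)) \<and>
    (\<forall>e\<in>E. \<forall>f\<in>E. \<forall>g\<in>E. e \<noteq> f \<and> e \<noteq> g \<and> f \<noteq> g \<longrightarrow>
       arc_interior (\<gamma> e) \<inter> arc_interior (\<gamma> f) \<inter> arc_interior (\<gamma> g) = {})"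

definition uncrossed_edges :: "'a set set \<Rightarrow> ('a set \<Rightarrow> real \<Rightarrow> complex) \<Rightarrow> 'a set set" where
  "uncrossed_edges E \<gamma> =
    {e \<in> E. \<forall>f\<in>E. f \<noteq> e \<longrightarrow> arc_interior (\<gamma> e) \<inter> arc_interior (\<gamma> f) = {}}"

text \<open>
  The supremum is over a set of natural numbers bounded by \<open>card E\<close>, and every finite
  simple graph has a drawing, so it is a maximum.
\<close>

definition max_uncrossed :: "'a set \<Rightarrow> 'a set set \<Rightarrow> nat" where
  "max_uncrossed V E = Sup {card (uncrossed_edges E \<gamma>) | p \<gamma>. drawing V E p \<gamma>}"

end

theory Submission
  imports Defs
begin

text \<open>
  Let \<open>H\<close> be the plane graph of the \<open>h\<close> uncrossed edges, with \<open>F\<close> faces and \<open>c\<close> components.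
  Every other edge runs inside one face of \<open>H\<close>, so it joins two vertices of the closure of a
  face. For a face \<open>f\<close> let \<open>v\<close> and \<open>e\<close> count the vertices and edges on its frontier, and let \<open>b\<close>
  be the number of components of the frontier. The face then holds at most \<open>(v choose 2) - e\<close>
  further edges. If \<open>F = 1\<close> then \<open>h \<le> n - 1\<close>, and \<open>m \<le> (n choose 2)\<close> suffices. If \<open>F \<ge> 2\<close>,
  Euler's formula for the frontier, which separates the plane, gives \<open>e \<ge> v + 1 - b\<close> and hence
  \<open>v \<ge> 3\<close>. Each edge lies on at most two faces, the sum of the \<open>b - 1\<close> is at most \<open>c - 1\<close>, and
  \<open>F = h - n + 1 + c\<close>. So the excesses \<open>v - 3\<close> add up to at most \<open>k = 3n - 6 - h\<close>, and convexity
  yields \<open>2m \<le> 6(n - 2) + k\<^sup>2 + k \<le> (k + sqrt (6(n - 2)))\<^sup>2\<close>.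

  The facts on plane graphs come from Janiszewski's theorem and the Jordan curve theorem, by
  studying how the complement of a compact set changes when an arc is attached to it.
\<close>

section \<open>Attaching an arc to a compact set\<close>

text \<open>Guarantees that attaching an arc never uses up a whole open face.\<close>

lemma interior_arc_image_empty:
  fixes g :: "real \<Rightarrow> complex"
  assumes "arc g"
  shows "interior (path_image g) = {}"
proof (rule ccontr)
  assume "interior (path_image g) \<noteq> {}"
  then obtain c r where r: "r > 0" "ball c r \<subseteq> path_image g"
    by (meson ex_in_conv mem_interior)
  obtain h where h: "homeomorphism {0..1} (path_image g) g h"
    using assms homeomorphism_arc by blast
  have "infinite (ball c r)"
    using r(1) uncountable_ball uncountable_infinite by blast
  then obtain S where S: "S \<subseteq> ball c r" "finite S" "card S = 3"
    using infinite_arbitrarily_large by blast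
  have inj: "inj_on h (path_image g)"
    using h unfolding homeomorphism_def by (metis inj_on_inverseI)
  then have "card (h ` S) = 3"
    using S r by (metis card_image inj_on_subset subset_trans)
  define T where "T = h ` S"
  have T: "card T = 3" "finite T" "T \<noteq> {}" using \<open>card (h ` S) = 3\<close> T_def S by auto
  define u w where "u = Min T" and "w = Max T"
  \<comment> \<open>Deleting one point of a disc leaves it connected, deleting \<open>v\<close> from \<open>[u, w]\<close> does not.\<close>
  have "card (T - {u, w}) > 0"
  proof -
    have "card {u,w} \<le> 2" by (cases "u = w") auto
    then have "card T - card {u, w} > 0" using T by auto
    moreover have "card T - card {u, w} \<le> card (T - {u, w})" by (intro diff_card_le_card_Diff) simp
    ultimately show ?thesis by linarith
  qed
  then obtain v where v: "v \<in> T" "v \<noteq> u" "v \<noteq> w"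
    by (metis DiffE all_not_in_conv card_gt_0_iff insertCI)
  have uw: "u \<in> T" "w \<in> T" using T u_def w_def by auto
  have "u \<le> v" "v \<le> w" using T v u_def w_def by auto
  then have lt: "u < v" "v < w" using v by auto
  obtain x y z where xyz: "x \<in> S" "y \<in> S" "z \<in> S" "u = h x" "v = h y" "w = h z"
    using uw v T_def by auto
  have conn: "connected (h ` (ball c r - {y}))"
  proof (rule connected_continuous_image)
    show "continuous_on (ball c r - {y}) h"
      using h r by (meson Diff_subset continuous_on_subset homeomorphism_def)
    show "connected (ball c r - {y})"
      using connected_open_delete[of "ball c r" y] by simp
  qed
  have "u \<in> h ` (ball c r - {y})" "w \<in> h ` (ball c r - {y})"
    using xyz S lt by auto
  then have "v \<in> h ` (ball c r - {y})"
    using conn lt by (meson connectedD_interval less_imp_le)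
  then obtain y' where "v = h y'" "y' \<in> ball c r - {y}" by (rule imageE)
  then have y': "y' \<in> ball c r" "y' \<noteq> y" "h y = h y'" by (simp_all flip: xyz(5))
  moreover have "y \<in> path_image g" "y' \<in> path_image g" using y' xyz(2) S(1) r(2) by auto
  ultimately show False using inj by (metis inj_onD)
qed

section \<open>Recognising connected components from a partition\<close>

lemma components_eqI:
  assumes "\<And>C. C \<in> \<C> \<Longrightarrow> C \<noteq> {} \<and> connected C \<and> openin (top_of_set S) C"
    and "pairwise disjnt \<C>" and "\<Union>\<C> = S"
  shows "components S = \<C>"
proof -
  have sub: "\<C> \<subseteq> components S"
  proof
    fix C assume C: "C \<in> \<C>"
    have "closedin (top_of_set S) C"
    proof -
      have "openin (top_of_set S) (\<Union>(\<C> - {C}))"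
        using assms(1) by blast
      moreover have "S - C = \<Union>(\<C> - {C})"
        using assms(2,3) C by (auto simp: pairwise_def disjnt_def)
      ultimately show ?thesis
        using C assms(3) by (metis Union_upper closedin_def topspace_euclidean_subtopology)
    qed
    moreover have "D = C" if D: "D \<noteq> {}" "C \<subseteq> D" "D \<subseteq> S" "connected D" for D
    proof -
      have "openin (top_of_set D) C" "closedin (top_of_set D) C"
        using D C assms(1) \<open>closedin (top_of_set S) C\<close>
        by (meson closedin_subset_trans openin_subset_trans)+
      then show ?thesis using D(4) C assms(1) by (metis connected_clopen)
    qed
    ultimately show "C \<in> components S"
      using C assms(1,3) by (auto simp: in_components_maximal)
  qed
  moreover have "C \<in> \<C>" if CS: "C \<in> components S" for C
  proof -
    obtain x where "x \<in> C" using in_components_nonempty[OF CS] by blast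
    then obtain D where D: "D \<in> \<C>" "x \<in> D"
      using assms(3) in_components_subset[OF CS] by blast
    then show ?thesis using components_eq[OF CS, of D] sub \<open>x \<in> C\<close> by auto
  qed
  ultimately show ?thesis by blast
qed

text \<open>Finiteness makes each member relatively open, because the remaining members have a
  closed union.\<close>

lemma components_finite_closed_eqI:
  assumes "finite \<C>" and "\<And>C. C \<in> \<C> \<Longrightarrow> C \<noteq> {} \<and> connected C \<and> closed C"
    and "pairwise disjnt \<C>" and "\<Union>\<C> = S"
  shows "components S = \<C>"
proof (rule components_eqI[OF _ assms(3,4)])
  fix C assume C: "C \<in> \<C>"
  have "closed (\<Union>(\<C> - {C}))" using assms(1,2) by auto
  moreover have "C = S - \<Union>(\<C> - {C})"
    using assms(3,4) C by (auto simp: pairwise_def disjnt_def)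
  ultimately have "openin (top_of_set S) C"
    by (metis Diff_eq Int_commute open_Compl openin_open_Int)
  then show "C \<noteq> {} \<and> connected C \<and> openin (top_of_set S) C"
    using assms(2) C by auto
qed

text \<open>Adding a limit point keeps a set connected, so a maximal connected subset absorbs all
  its limit points in \<open>U\<close>.\<close>

lemma closure_component_open_Int:
  fixes U :: "'a::real_normed_vector set"
  assumes "open U" "C \<in> components U"
  shows "closure C \<inter> U = C"
proof
  show "closure C \<inter> U \<subseteq> C"
  proof
    fix x assume x: "x \<in> closure C \<inter> U"
    have "connected (insert x C)"
      by (rule connected_intermediate_closure[of C])
        (use assms x closure_subset in_components_connected in auto)
    moreover have "insert x C \<subseteq> U" "C \<inter> insert x C \<noteq> {}"
      using x in_components_subset[OF assms(2)] in_components_nonempty[OF assms(2)] by auto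
    ultimately have "insert x C \<subseteq> C"
      by (rule components_maximal[OF assms(2)])
    then show "x \<in> C" by blast
  qed
  show "C \<subseteq> closure C \<inter> U"
    using assms closure_subset in_components_subset by blast
qed

text \<open>\<open>L\<close> stands for what is already drawn and need not be a graph: later it is
  also the frontier of a face, or a compact set to be bridged by a segment.\<close>

locale arc_attachment =
  fixes L :: "complex set" and g :: "real \<Rightarrow> complex"
  assumes compact_L: "compact L" and arc_g: "arc g"
    and meets: "path_image g \<inter> L = {pathstart g, pathfinish g}"
begin

abbreviation A :: "complex set" where "A \<equiv> path_image g"

text \<open>The midpoint is only a sample. The open arc is connected and misses \<open>L\<close>, so
  all of it lies in this component of the complement (\<open>interior_in_face\<close>).\<close>

definition face :: "complex set" where
  "face = connected_component_set (- L) (g (1/2))"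

section \<open>The arc and the face that contains its interior\<close>

lemma g_eq_iff: "s \<in> {0..1} \<Longrightarrow> t \<in> {0..1} \<Longrightarrow> g s = g t \<longleftrightarrow> s = t"
  using arc_g by (auto simp: arc_def inj_on_def)

lemma cont_g: "continuous_on {0..1} g"
  using arc_g by (simp add: arc_def path_def)

lemma interval_image:
  assumes "0 \<le> s" "s \<le> t" "t \<le> 1"
  shows "compact (g ` {s..t})" "connected (g ` {s..t})" "connected (- g ` {s..t})"
proof -
  have c: "continuous_on {s..t} g"
    using cont_g assms by (meson atLeastatMost_subset_iff continuous_on_subset)
  then show "compact (g ` {s..t})" "connected (g ` {s..t})"
    by (auto intro: compact_continuous_image connected_continuous_image)
  show "connected (- g ` {s..t})"
  proof (cases "s = t")
    case True
    then show ?thesis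
      using path_connected_imp_connected[OF path_connected_complement_countable[of "{g t}"]] by simp
  next
    case False
    then have "arc (subpath s t g)" using assms arc_g by (intro arc_subpath_arc) auto
    then show ?thesis
      using connected_arc_complement[of "subpath s t g"] assms by (simp add: path_image_subpath)
  qed
qed

lemma A_eq: "A = g ` {0<..<1} \<union> {g 0, g 1}"
proof -
  have "{0..1} = {0<..<1} \<union> {0, 1::real}" by auto
  then show ?thesis unfolding path_image_def by (metis image_Un image_insert image_empty)
qed

lemma ends_L: "g 0 \<in> L" "g 1 \<in> L"
  using meets by (auto simp: pathstart_def pathfinish_def)

lemma g_in_L_iff: "t \<in> {0..1} \<Longrightarrow> g t \<in> L \<longleftrightarrow> t = 0 \<or> t = 1"
proof
  assume t: "t \<in> {0..1}" "g t \<in> L"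
  then have "g t \<in> A \<inter> L" by (auto simp: path_image_def)
  then have "g t = g 0 \<or> g t = g 1" using meets by (auto simp: pathstart_def pathfinish_def)
  then show "t = 0 \<or> t = 1" using g_eq_iff[of t 0] g_eq_iff[of t 1] t by auto
qed (use ends_L in auto)

lemma closed_L: "closed L" using compact_L compact_imp_closed by blast

lemma compact_A: "compact A" using arc_g by (simp add: compact_arc_image)

lemma closed_A: "closed A" using compact_A compact_imp_closed by blast

lemma face_component: "face \<in> components (- L)"
  unfolding face_def using g_in_L_iff[of "1/2"] by (intro componentsI) auto

lemma open_face: "open face"
  using face_component closed_L open_components by blast

lemma connected_face: "connected face"
  using face_component in_components_connected by blast

lemma face_disjoint_L: "face \<inter> L = {}"
  using face_component in_components_subset by blast

lemma interior_in_face: "g ` {0<..<1} \<subseteq> face"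
proof (rule components_maximal[OF face_component])
  show "connected (g ` {0<..<1})"
    by (rule connected_continuous_image) (auto intro: continuous_on_subset[OF cont_g])
  show "g ` {0<..<1} \<subseteq> - L" using g_in_L_iff by force
  have "g (1/2) \<in> face \<inter> g ` {0<..<1}"
    using g_in_L_iff[of "1/2"] by (auto simp: face_def connected_component_refl_eq)
  then show "face \<inter> g ` {0<..<1} \<noteq> {}" by blast
qed

lemma face_Diff_A_nonempty: "face - A \<noteq> {}"
proof
  assume "face - A = {}"
  then have "face \<subseteq> interior A" using open_face by (simp add: interior_maximal)
  then show False
    using interior_arc_image_empty[OF arc_g] face_component in_components_nonempty by blast
qed

text \<open>The arc stays in \<open>face\<close> apart from its ends on \<open>L\<close>, so all
  other faces survive and only \<open>face\<close> is cut.\<close>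

lemma components_Compl_Un:
  "components (- (L \<union> A)) = (components (- L) - {face}) \<union> components (face - A)"
proof (rule components_eqI)
  have op: "open C" if "C \<in> components (- L) \<union> components (face - A)" for C
    using that open_components[of "- L" C] open_components[of "face - A" C] closed_L closed_A open_face
    by (auto simp: open_Compl open_Diff)
  have sub: "C \<subseteq> - (L \<union> A)"
    if C: "C \<in> (components (- L) - {face}) \<union> components (face - A)" for C
  proof (cases "C \<in> components (face - A)")
    case True
    then show ?thesis using in_components_subset face_disjoint_L by fastforce
  next
    case False
    then have "C \<in> components (- L)" "C \<noteq> face" using C by auto
    then have "C \<subseteq> - L" "C \<inter> face = {}"
      using in_components_subset[of C] components_nonoverlap[OF _ face_component, of C] by auto
    moreover have "A \<subseteq> face \<union> L" using A_eq interior_in_face ends_L by blast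
    ultimately show ?thesis by blast
  qed
  fix C assume C: "C \<in> (components (- L) - {face}) \<union> components (face - A)"
  have "openin (top_of_set (- (L \<union> A))) C" using op[of C] sub[OF C] C openin_open_eq[of "- (L \<union> A)" C]
      closed_L closed_A by (auto simp: open_Compl closed_Un)
  then show "C \<noteq> {} \<and> connected C \<and> openin (top_of_set (- (L \<union> A))) C"
    using C in_components_nonempty in_components_connected by blast
next
  show "pairwise disjnt (components (- L) - {face} \<union> components (face - A))"
  proof (rule pairwiseI)
    fix C D assume CD: "C \<in> components (- L) - {face} \<union> components (face - A)"
      "D \<in> components (- L) - {face} \<union> components (face - A)" "C \<noteq> D"
    have "disjnt X Y" if "X \<in> components (- L) - {face}" "Y \<in> components (face - A)" for X Y
    proof -
      have "X \<inter> face = {}" "Y \<subseteq> face"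
        using that components_nonoverlap face_component in_components_subset by blast+
      then show ?thesis by (auto simp: disjnt_def)
    qed
    moreover have "disjnt X Y" if "X \<in> components Z" "Y \<in> components Z" "X \<noteq> Y" for X Y Z :: "complex set"
      using that components_nonoverlap by (auto simp: disjnt_def)
    ultimately show "disjnt C D" using CD by (metis UnE disjnt_sym DiffD1)
  qed
  have "\<Union>(components (- L) - {face}) = - L - face"
    using in_components_unions_complement[OF face_component] by simp
  moreover have "A \<subseteq> face \<union> L" using A_eq interior_in_face ends_L by blast
  ultimately show "\<Union>(components (- L) - {face} \<union> components (face - A)) = - (L \<union> A)"
    using face_disjoint_L unfolding Union_Un_distrib Union_components by auto
qed

text \<open>Janiszewski's theorem is applied twice, once for each stub of the arc. Each stub has
  connected complement and meets the set built so far in a single point, so it separates nothing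
  new.\<close>

lemma not_separated_minus_gap:
  assumes st: "0 \<le> s" "s < t" "t \<le> 1"
    and x: "x \<in> face - g ` {0..s} - g ` {t..1}" and y: "y \<in> face - g ` {0..s} - g ` {t..1}"
  shows "connected_component (- (L \<union> g ` {0..s} \<union> g ` {t..1})) x y"
proof -
  have cc: "connected_component (- T) x y" if "connected (- T)" "x \<notin> T" "y \<notin> T" for T
    using that by (meson ComplI connected_iff_connected_component)
  have xL: "connected_component (- L) x y"
    using x y face_component by (metis DiffD1 connected_component_def in_components_connected in_components_subset)
  have "L \<inter> g ` {0..s} = {g 0}"
    using g_in_L_iff st ends_L by force
  moreover have "compact (g ` {0..s})" "connected (- g ` {0..s})" using interval_image[of 0 s] st by auto
  ultimately have s1: "connected_component (- (L \<union> g ` {0..s})) x y"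
    using x y compact_L compact_imp_closed xL cc[of "g ` {0..s}"] Janiszewski[of L "g ` {0..s}" x y] by auto
  have "(L \<union> g ` {0..s}) \<inter> g ` {t..1} = {g 1}"
  proof -
    have "L \<inter> g ` {t..1} = {g 1}" using g_in_L_iff st ends_L by force
    moreover have "g ` {0..s} \<inter> g ` {t..1} = {}"
      using st g_eq_iff by (force simp: disjoint_iff)
    ultimately show ?thesis by blast
  qed
  then have con: "connected ((L \<union> g ` {0..s}) \<inter> g ` {t..1})" by simp
  have "compact (L \<union> g ` {0..s})" "closed (g ` {t..1})" "connected (- g ` {t..1})"
    using compact_L interval_image[of 0 s] interval_image[of t 1] st compact_imp_closed by auto
  then show ?thesis
    using x y con s1 cc[of "g ` {t..1}"] Janiszewski[of "L \<union> g ` {0..s}" "g ` {t..1}" x y] by simp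
qed

lemma connected_face_minus_gap:
  assumes st: "0 \<le> s" "s < t" "t \<le> 1"
  shows "connected (face - g ` {0..s} - g ` {t..1})" (is "connected ?f")
  unfolding connected_iff_connected_component
proof (intro ballI)
  fix x y assume xy: "x \<in> ?f" "y \<in> ?f"
  obtain T where T: "connected T" "T \<subseteq> - (L \<union> g ` {0..s} \<union> g ` {t..1})" "x \<in> T" "y \<in> T"
    using not_separated_minus_gap[OF st xy] by (auto simp: connected_component_def)
  have "T \<subseteq> face"
    by (rule components_maximal[OF face_component]) (use T xy in auto)
  with T have "T \<subseteq> ?f" by blast
  then show "connected_component ?f x y" using T unfolding connected_component_def by blast
qed

text \<open>Around an interior point of the arc leave a small gap between two stubs. The face
  without the stubs is connected, and a piece of the cut face is a proper open subset of it, hence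
  not relatively closed: it has a limit point on the arc inside the gap. Shrinking the gap reaches
  every interior point, and continuity the ends.\<close>

lemma arc_subset_closure_piece:
  assumes C: "C \<in> components (face - A)"
  shows "A \<subseteq> closure C"
proof -
  have op: "open (face - A)" using open_face closed_A by auto
  have opC: "open C" and Cs: "C \<subseteq> face - A" and Cne: "C \<noteq> {}"
    using C op open_components in_components_subset in_components_nonempty by blast+
  have "g u \<in> closure C" if u: "u \<in> {0<..<1}" for u
    unfolding closure_approachable
  proof (intro allI impI)
    fix e :: real assume "e > 0"
    then obtain d where d: "d > 0" "\<And>v. v \<in> {0..1} \<Longrightarrow> dist v u < d \<Longrightarrow> dist (g v) (g u) < e"
      using cont_g u unfolding continuous_on_iff
      by (metis atLeastAtMost_iff greaterThanLessThan_iff less_imp_le)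
    \<comment> \<open>Small enough for the gap to stay in the unit interval and for its image to
      stay within \<open>e\<close> of \<open>g u\<close>.\<close>
    define r where "r = min (d/2) (min u (1-u))"
    have r: "r > 0" "r < d" "0 \<le> u - r" "u + r \<le> 1" using d u by (auto simp: r_def min_def)
    let ?f = "face - g ` {0..u-r} - g ` {u+r..1}"
    have con: "connected ?f" by (rule connected_face_minus_gap) (use r in auto)
    have "C \<subseteq> ?f"
      using Cs r u by (fastforce simp: path_image_def)
    have gu: "g u \<in> ?f - C"
    proof -
      have "g u \<notin> g ` {0..u-r}" "g u \<notin> g ` {u+r..1}"
        using g_eq_iff u r by (force)+
      moreover have "g u \<in> face" "g u \<in> A" using u interior_in_face by (auto simp: path_image_def)
      ultimately show ?thesis using Cs by auto
    qed
    have "\<not> closedin (top_of_set ?f) C"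
    proof
      assume "closedin (top_of_set ?f) C"
      moreover have "openin (top_of_set ?f) C"
        using opC \<open>C \<subseteq> ?f\<close> by (simp add: open_subset)
      ultimately show False using con Cne gu by (metis DiffE connected_clopen)
    qed
    moreover have "closedin (top_of_set ?f) (?f \<inter> closure C)"
      by (rule closedin_closed_Int) simp
    ultimately have "?f \<inter> closure C \<noteq> C" by metis
    then have "\<not> ?f \<inter> closure C \<subseteq> C"
      using \<open>C \<subseteq> ?f\<close> closure_subset[of C] by blast
    then obtain y where y: "y \<in> ?f" "y \<in> closure C" "y \<notin> C" by blast
    \<comment> \<open>Inside \<open>face - A\<close> the piece has no limit points but its own, so
      \<open>y\<close> is on the arc; avoiding both stubs, it is in the gap.\<close>
    then have "y \<in> A" using closure_component_open_Int[OF op C] by blast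
    then obtain v where v: "v \<in> {0..1}" "y = g v" by (auto simp: path_image_def)
    then have "v \<notin> {0..u-r}" "v \<notin> {u+r..1}" using y by auto
    then have "dist v u < d" using v r by (auto simp: dist_real_def)
    then have "dist y (g u) < e" using d v by auto
    obtain z where z: "z \<in> C" "dist z y < e - dist y (g u)"
      using y(2) \<open>dist y (g u) < e\<close> by (meson closure_approachable diff_gt_0_iff_gt)
    then show "\<exists>y\<in>C. dist y (g u) < e"
      by (metis dist_triangle_lt dist_commute less_diff_eq add.commute)
  qed
  then have I: "g ` {0<..<1} \<subseteq> closure C" by auto
  have "g ` closure {0<..<1} \<subseteq> closure C"
    by (rule image_closure_subset) (use I cont_g in auto)
  then show ?thesis by (simp add: path_image_def)
qed

section \<open>The number of pieces into which the arc cuts its face\<close>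

lemma connected_component_face:
  assumes "x \<in> face" "y \<in> face" shows "connected_component (- L) x y"
  using assms connected_face face_component in_components_subset connected_component_def by metis

lemma not_separated_pieceD:
  assumes "connected_component (- (L \<union> A)) x y" and D: "D \<in> components (face - A)" "x \<in> D"
  shows "y \<in> D"
proof -
  obtain T where T: "connected T" "T \<subseteq> - (L \<union> A)" "x \<in> T" "y \<in> T"
    using assms by (auto simp: connected_component_def)
  have "x \<in> face" using D in_components_subset by fastforce
  have "T \<subseteq> face"
    by (rule components_maximal[OF face_component]) (use T \<open>x \<in> face\<close> in auto)
  then have "T \<subseteq> D"
    by (intro components_maximal[OF D(1)]) (use T D in auto)
  then show ?thesis using T by auto
qed

text \<open>An arc joining two separate parts of \<open>L\<close> does not cut its face. By
  Janiszewski's theorem nothing is separated when \<open>A\<close> is added to \<open>K0\<close>,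
  nor when \<open>K1\<close> is added to the result, since each time the intersection is one
  point.\<close>

lemma connected_face_Diff_arc:
  assumes K: "closed K0" "closed K1" "K0 \<inter> K1 = {}" "L = K0 \<union> K1" "g 0 \<in> K0" "g 1 \<in> K1"
  shows "connected (face - A)"
  unfolding connected_iff_connected_component
proof (intro ballI)
  fix x y assume xy: "x \<in> face - A" "y \<in> face - A"
  have xL: "connected_component (- L) x y" using xy connected_component_face by auto
  have cA: "connected_component (- A) x y"
    using connected_arc_complement[OF arc_g] xy by (auto simp: connected_iff_connected_component)
  have "A \<inter> L = {g 0, g 1}" using meets by (simp add: pathstart_def pathfinish_def)
  then have A: "A \<inter> K0 \<union> A \<inter> K1 = {g 0, g 1}" using K(4) by (simp add: Int_Un_distrib)
  have ne: "g 0 \<notin> K1" "g 1 \<notin> K0" using K by auto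
  have i: "K0 \<inter> A = {g 0}" "(K0 \<union> A) \<inter> K1 = {g 1}"
    using A ne K(3,5,6) by (auto simp: set_eq_iff)
  have cK: "compact K0" using K compact_L closed_L
    by (metis Un_upper1 compact_Int_closed inf.absorb_iff2)
  have sub: "connected_component (- K0) x y" "connected_component (- K1) x y"
    using xL connected_component_of_subset K(4) by (metis Compl_anti_mono Un_upper1 Un_upper2)+
  have "connected_component (- (K0 \<union> A)) x y"
    using Janiszewski[OF cK closed_A] i sub cA by simp
  then have "connected_component (- ((K0 \<union> A) \<union> K1)) x y"
    using Janiszewski[of "K0 \<union> A" K1 x y] i(2) sub(2) K(2) compact_Un[OF cK compact_A] by simp
  then have cc: "connected_component (- (L \<union> A)) x y"
    by (simp add: K(4) sup_commute sup_left_commute)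
  obtain D where D: "D \<in> components (face - A)" "x \<in> D"
    using xy Union_components by blast
  then have "y \<in> D" using not_separated_pieceD[OF cc] by auto
  then show "connected_component (face - A) x y"
    using D in_components_connected in_components_subset unfolding connected_component_def by metis
qed

lemma closed_other_components:
  assumes "finite (components L)"
  shows "closed (\<Union>(components L - \<C>))"
  using assms closed_components[OF closed_L] by auto

lemma components_face_Diff_arc_distinct:
  assumes fin: "finite (components L)" and C: "C \<in> components L" "g 0 \<in> C" "g 1 \<notin> C"
  shows "components (face - A) = {face - A}"
proof -
  have "\<Union>(components L - {C}) = L - C"
    using in_components_unions_complement[OF C(1)] by simp
  then have "connected (face - A)"
    using C ends_L in_components_subset[OF C(1)] closed_components[OF closed_L C(1)]
      closed_other_components[OF fin, of "{C}"]
    by (intro connected_face_Diff_arc[of C "L - C"]) auto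
  then show ?thesis using face_Diff_A_nonempty by (simp add: components_eq_sing_iff)
qed

text \<open>Path-connectedness of \<open>C\<close> closes the arc up to a Jordan curve whose return
  path runs in \<open>C\<close>, away from the face. Every point of the curve is on the frontier of
  both sides, so the open set \<open>face\<close>, which contains \<open>g (1/2)\<close>, meets
  both.\<close>

lemma not_connected_face_Diff_arc:
  assumes C: "C \<subseteq> L" "path_connected C" "g 0 \<in> C" "g 1 \<in> C"
  shows "\<not> connected (face - A)"
proof
  assume con: "connected (face - A)"
  have "g 1 \<noteq> g 0" using g_eq_iff[of 0 1] by auto
  then obtain q where q: "arc q" "path_image q \<subseteq> C" "pathstart q = g 1" "pathfinish q = g 0"
    using C by (metis path_connected_arcwise)
  let ?c = "g +++ q"
  have im: "path_image ?c = A \<union> path_image q"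
    using q by (intro path_image_join) (simp add: pathfinish_def)
  have "A \<inter> path_image q \<subseteq> {g 0, g 1}" using meets q C by (auto simp: pathstart_def pathfinish_def)
  then have "simple_path ?c"
    by (intro simple_path_join_loop) (use arc_g q in \<open>auto simp: pathstart_def pathfinish_def\<close>)
  moreover have "pathfinish ?c = pathstart ?c" using q by simp (simp add: pathstart_def)
  ultimately have J: "open (inside (path_image ?c))" "open (outside (path_image ?c))"
     "inside (path_image ?c) \<inter> outside (path_image ?c) = {}"
     "inside (path_image ?c) \<union> outside (path_image ?c) = - path_image ?c"
     "frontier (inside (path_image ?c)) = path_image ?c"
     "frontier (outside (path_image ?c)) = path_image ?c"
    using Jordan_inside_outside[of ?c] by blast+
  have gf: "g (1/2) \<in> face" using interior_in_face by auto
  have gi: "g (1/2) \<in> path_image ?c" unfolding im by (auto simp: path_image_def)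
  have meet: "face \<inter> W \<noteq> {}" if "frontier W = path_image ?c" for W
    using gi gf that open_face open_Int_closure_eq_empty[of face W] by (auto simp: frontier_def)
  have sub: "face - A \<subseteq> inside (path_image ?c) \<union> outside (path_image ?c)"
    using J(4) im q C face_disjoint_L by auto
  have "inside (path_image ?c) \<inter> A = {}" "outside (path_image ?c) \<inter> A = {}"
    using J(4) im by blast+
  then have "inside (path_image ?c) \<inter> (face - A) \<noteq> {}" "outside (path_image ?c) \<inter> (face - A) \<noteq> {}"
    using meet[OF J(5)] meet[OF J(6)] by blast+
  then show False
    using con sub J(1-3) connectedD[OF con J(1,2)] by blast
qed

text \<open>A point of the piece close to the arc is joined to its nearest point on the arc: the
  segment cannot hit the arc earlier, and inside a small ball it stays in the face, hence in the
  piece.\<close>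

lemma accessible_point:
  assumes D: "D \<in> components (face - A)" and st: "0 < s" "s < t" "t < 1"
  obtains x w where "x \<in> D" "w \<in> g ` {s..t}" "closed_segment x w \<subseteq> insert w D"
proof -
  define u where "u = (s + t) / 2"
  have u: "s < u" "u < t" using st by (auto simp: u_def)
  let ?B = "g ` {0..s} \<union> g ` {t..1}"
  have "closed ?B" using interval_image[of 0 s] interval_image[of t 1] st compact_imp_closed by auto
  then have "open (face - ?B)" using open_face by auto
  moreover have "g u \<in> face - ?B"
  proof -
    have "g u \<notin> ?B" using g_eq_iff u st by force
    then show ?thesis using interior_in_face u st by auto
  qed
  ultimately obtain e where e: "e > 0" "ball (g u) e \<subseteq> face - ?B"
    by (meson openE)
  have "g u \<in> closure D"
    using arc_subset_closure_piece[OF D] u st by (auto simp: path_image_def)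
  \<comment> \<open>Half the radius, because the nearest point \<open>w\<close> is at most as far
    from \<open>x\<close> as \<open>g u\<close> is, and must still fall in the ball.\<close>
  then obtain x where x: "x \<in> D" "dist x (g u) < e / 2"
    using e by (meson closure_approachable half_gt_zero)
  define w where "w = closest_point A x"
  have w: "w \<in> A" "dist x w \<le> dist x (g u)"
    unfolding w_def using closest_point_in_set[OF closed_A] closest_point_le[OF closed_A] u st
    by (auto simp: path_image_def)
  have xw: "x \<in> ball (g u) e" "w \<in> ball (g u) e"
    using x w e dist_triangle[of "g u" w x] by (auto simp: dist_commute)
  then have "w \<notin> ?B" using e by auto
  then have "w \<in> g ` {s..t}" using w st by (force simp: path_image_def)
  moreover have "closed_segment x w \<subseteq> insert w D"
  proof -
    have "x \<noteq> w" using x w D in_components_subset by blast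
    have "open_segment x w \<inter> A = {}"
      unfolding w_def using segment_to_closest_point[OF closed_A] w by blast
    moreover have "open_segment x w \<subseteq> ball (g u) e"
      using xw by (meson convex_ball convex_contains_open_segment)
    ultimately have sub: "insert x (open_segment x w) \<subseteq> face - A"
      using e x D in_components_subset by fastforce
    have "connected (insert x (open_segment x w))"
      by (rule connected_intermediate_closure[of "open_segment x w"])
         (use \<open>x \<noteq> w\<close> in \<open>auto simp: open_closed_segment convex_connected\<close>)
    then have "insert x (open_segment x w) \<subseteq> D"
      using sub x by (intro components_maximal[OF D]) auto
    then show ?thesis by (auto simp: open_segment_def)
  qed
  ultimately show thesis using that x by blast
qed

text \<open>Each piece has the whole arc in its closure, so each remains connected when the open
  subarc is added, and the two enlarged sets share that subarc.\<close>

lemma connected_pieces_gap: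
  assumes "D \<in> components (face - A)" "D' \<in> components (face - A)" and st: "0 \<le> s" "s < t" "t \<le> 1"
  shows "connected (D \<union> g ` {s<..<t} \<union> D')"
proof -
  have I: "g ` {s<..<t} \<subseteq> A" using st by (auto simp: path_image_def)
  have c: "connected (E \<union> g ` {s<..<t})" if "E \<in> components (face - A)" for E
    by (rule connected_intermediate_closure[of E])
      (use that I arc_subset_closure_piece[OF that] in_components_connected closure_subset[of E] in auto)
  have "g ((s+t)/2) \<in> g ` {s<..<t}" using st by auto
  then have "connected ((D \<union> g ` {s<..<t}) \<union> (D' \<union> g ` {s<..<t}))"
    using c[OF assms(1)] c[OF assms(2)] by (intro connected_Un[of "D \<union> g ` {s<..<t}"]) auto
  then show ?thesis by (simp add: Un_ac)
qed

text \<open>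
  Join two parts of the arc by a continuum \<open>R\<close> inside the first piece. The two compact sets to
  which Janiszewski's theorem is applied are the component \<open>C\<close> of \<open>L\<close>, the arc and \<open>R\<close>, each without
  one open subarc: the other two pieces are joined through the missing subarc, and \<open>R\<close> makes
  the intersection connected.
\<close>

lemma pieces_not_three:
  assumes fin: "finite (components L)" and C: "C \<in> components L" "g 0 \<in> C" "g 1 \<in> C"
    and D: "D1 \<in> components (face - A)" "D2 \<in> components (face - A)" "D3 \<in> components (face - A)"
  shows "D1 = D2 \<or> D1 = D3 \<or> D2 = D3"
proof (rule ccontr)
  assume "\<not> ?thesis"
  then have dis: "D1 \<inter> D2 = {}" "D1 \<inter> D3 = {}" "D2 \<inter> D3 = {}"
    using components_nonoverlap D by blast+
  have Ds: "D1 \<subseteq> face - A" "D2 \<subseteq> face - A" "D3 \<subseteq> face - A"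
    using D in_components_subset by blast+
  obtain x w where xw: "x \<in> D1" "w \<in> g ` {1/8..1/4}" "closed_segment x w \<subseteq> insert w D1"
    using accessible_point[OF D(1), of "1/8" "1/4"] by auto
  obtain y z where yz: "y \<in> D1" "z \<in> g ` {1/2..3/4}" "closed_segment y z \<subseteq> insert z D1"
    using accessible_point[OF D(1), of "1/2" "3/4"] by auto
  have "open D1" using D(1) open_face closed_A open_components by blast
  then have "path_connected D1"
    using D(1) in_components_connected connected_open_path_connected by blast
  then obtain p where p: "path p" "path_image p \<subseteq> D1" "pathstart p = x" "pathfinish p = y"
    using xw yz by (meson path_connected_def)
  define R where "R = closed_segment x w \<union> path_image p \<union> closed_segment y z"
  have "x \<in> path_image p" "y \<in> path_image p" using p by auto
  then have R: "compact R" "connected R" "w \<in> R" "z \<in> R" "R \<subseteq> D1 \<union> {w, z}"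
    unfolding R_def using xw yz p
    by (auto intro!: connected_Un compact_Un compact_path_image connected_path_image)
  obtain x2 x3 where x23: "x2 \<in> D2" "x3 \<in> D3" using D in_components_nonempty by blast
  \<comment> \<open>The missing subarcs are (1/4, 1/2) and (3/4, 1). The common part of
    \<open>?X\<close> and \<open>?Y\<close> consists of one subarc containing \<open>w\<close> and
    attached to \<open>C\<close>, and another containing \<open>z\<close>; \<open>R\<close> links
    the two.\<close>
  let ?X = "g ` ({0..1/4} \<union> {1/2..1})" and ?Y = "g ` {0..3/4}"
  let ?S = "C \<union> ?X \<union> R" and ?T = "C \<union> ?Y \<union> R"
  have CL: "C \<subseteq> L" using C in_components_subset by blast
  have clC: "compact C" using compact_components[OF compact_L C(1)] .
  have cR: "closed R" using R compact_imp_closed by blast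
  have XY: "?X \<inter> ?Y = g ` {0..1/4} \<union> g ` {1/2..3/4}"
  proof -
    have "?X \<inter> ?Y = g ` (({0..1/4} \<union> {1/2..1}) \<inter> {0..3/4})"
      by (rule inj_on_image_Int[symmetric, of _ "{0..1}"]) (use arc_g in \<open>auto simp: arc_def\<close>)
    also have "({0..1/4} \<union> {1/2..1}) \<inter> {0..3/4} = {0..1/4} \<union> {1/2..3/4::real}" by auto
    finally show ?thesis by (simp add: image_Un)
  qed
  have "connected (C \<union> g ` {0..1/4} \<union> R \<union> g ` {1/2..3/4})"
  proof (intro connected_Un)
    show "C \<inter> g ` {0..1/4} \<noteq> {}" using C by auto
    have "w \<in> g ` {0..1/4}" using xw by auto
    then show "(C \<union> g ` {0..1/4}) \<inter> R \<noteq> {}" using R by auto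
    show "(C \<union> g ` {0..1/4} \<union> R) \<inter> g ` {1/2..3/4} \<noteq> {}" using R yz by auto
  qed (use interval_image[of 0 "1/4"] interval_image[of "1/2" "3/4"] R C in_components_connected in auto)
  moreover have "?S \<inter> ?T = C \<union> (?X \<inter> ?Y) \<union> R" by blast
  ultimately have conST: "connected (?S \<inter> ?T)" unfolding XY by (simp add: Un_ac)
  have compX: "compact ?X" unfolding image_Un
    using interval_image[of 0 "1/4"] interval_image[of "1/2" 1] by auto
  have compY: "compact ?Y" using interval_image[of 0 "3/4"] by auto
  have RA: "R \<inter> g ` {1/4<..<1/2} = {}" "R \<inter> g ` {3/4<..<1} = {}"
  proof -
    have "w \<notin> g ` {1/4<..<1/2}" "w \<notin> g ` {3/4<..<1}" "z \<notin> g ` {1/4<..<1/2}" "z \<notin> g ` {3/4<..<1}"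
      using xw(2) yz(2) g_eq_iff by force+
    moreover have "g ` {1/4<..<1/2} \<subseteq> A" "g ` {3/4<..<1} \<subseteq> A" by (auto simp: path_image_def)
    ultimately show "R \<inter> g ` {1/4<..<1/2} = {}" "R \<inter> g ` {3/4<..<1} = {}"
      using R Ds by blast+
  qed
  have XA: "?X \<subseteq> A" "?Y \<subseteq> A" by (auto simp: path_image_def)
  have wzA: "w \<in> A" "z \<in> A" using xw yz by (auto simp: path_image_def)
  have gX: "?X \<inter> g ` {1/4<..<1/2} = {}" "?Y \<inter> g ` {3/4<..<1} = {}"
    using g_eq_iff by (force)+
  have gC: "C \<inter> g ` {1/4<..<1/2} = {}" "C \<inter> g ` {3/4<..<1} = {}"
    using CL g_in_L_iff by force+
  have disj: "D2 \<inter> (C \<union> A \<union> R) = {}" "D3 \<inter> (C \<union> A \<union> R) = {}"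
  proof -
    have "E \<inter> (C \<union> A \<union> R) = {}" if "E \<subseteq> face - A" "D1 \<inter> E = {}" for E
      using that R(5) CL face_disjoint_L wzA by blast
    then show "D2 \<inter> (C \<union> A \<union> R) = {}" "D3 \<inter> (C \<union> A \<union> R) = {}"
      using Ds dis by auto
  qed
  have cc: "connected_component (- X) x2 x3" if "D2 \<union> G \<union> D3 \<subseteq> - X" "connected (D2 \<union> G \<union> D3)" for X G
    unfolding connected_component_def by (rule exI[of _ "D2 \<union> G \<union> D3"]) (use that x23 in blast)
  have aux: "D2 \<union> G \<union> D3 \<subseteq> - (C \<union> X \<union> R)"
    if "X \<subseteq> A" "X \<inter> G = {}" "C \<inter> G = {}" "R \<inter> G = {}" for X G
    using disj that by blast
  have "D2 \<union> g ` {1/4<..<1/2} \<union> D3 \<subseteq> - ?S"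
    using gX gC RA XA by (intro aux)
  then have S: "connected_component (- ?S) x2 x3"
    by (rule cc) (rule connected_pieces_gap[OF D(2,3)], auto)
  have "D2 \<union> g ` {3/4<..<1} \<union> D3 \<subseteq> - ?T"
    using gX gC RA XA by (intro aux)
  then have T: "connected_component (- ?T) x2 x3"
    by (rule cc) (rule connected_pieces_gap[OF D(2,3)], auto)
  have "connected_component (- (?S \<union> ?T)) x2 x3"
    by (rule Janiszewski[OF _ _ conST S T]) (use clC compX compY R cR compact_imp_closed in auto)
  moreover have "A \<subseteq> ?X \<union> ?Y" by (force simp: path_image_def)
  ultimately have CA: "connected_component (- (C \<union> A)) x2 x3"
    by (rule_tac connected_component_of_subset) auto
  \<comment> \<open>The other components of \<open>L\<close> are restored at the end. They are
    disjoint from \<open>C \<union> A\<close>, and the empty intersection is connected, so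
    Janiszewski's theorem applies once more.\<close>
  let ?Q = "\<Union>(components L - {C})"
  have Q: "?Q = L - C" using in_components_unions_complement[OF C(1)] by simp
  have "x2 \<in> face" "x3 \<in> face" using x23 Ds by auto
  then have "connected_component (- ?Q) x2 x3"
    using connected_component_of_subset[OF connected_component_face[of x2 x3]] Q by blast
  moreover have "(C \<union> A) \<inter> ?Q = {}"
  proof -
    have "A \<inter> L \<subseteq> C" unfolding meets using C by (simp add: pathstart_def pathfinish_def)
    then show ?thesis unfolding Q by blast
  qed
  ultimately have "connected_component (- ((C \<union> A) \<union> ?Q)) x2 x3"
    using Janiszewski[of "C \<union> A" ?Q x2 x3] CA compact_Un[OF clC compact_A] closed_other_components[OF fin] by simp
  moreover have "(C \<union> A) \<union> ?Q = L \<union> A" unfolding Q using CL by blast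
  ultimately have "x3 \<in> D2" using not_separated_pieceD[OF _ D(2) x23(1)] by simp
  then show False using x23 dis by blast
qed

lemma card_pieces_le_2:
  assumes fin: "finite (components L)"
  shows "finite (components (face - A))" "card (components (face - A)) \<le> 2"
proof -
  obtain C where C: "C \<in> components L" "g 0 \<in> C" using ends_L Union_components by blast
  have "finite (components (face - A)) \<and> card (components (face - A)) \<le> 2"
  proof (cases "g 1 \<in> C")
    case True
    show ?thesis
    proof (rule ccontr)
      assume "\<not> ?thesis"
      then obtain X where X: "X \<subseteq> components (face - A)" "card X = 3"
        by (metis One_nat_def Suc_1 eval_nat_numeral(3) infinite_arbitrarily_large not_less_eq_eq
            obtain_subset_with_card_n)
      then obtain a b c where "X = {a, b, c}" "a \<noteq> b" "b \<noteq> c" "a \<noteq> c"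
        by (auto simp: card_3_iff)
      then show False using pieces_not_three[OF fin C True, of a b c] X by auto
    qed
  next
    case False
    then show ?thesis using components_face_Diff_arc_distinct[OF fin C] by auto
  qed
  then show "finite (components (face - A))" "card (components (face - A)) \<le> 2" by auto
qed

text \<open>A face other than those cut from \<open>face\<close> is disjoint from the open set
  \<open>face\<close>. So is its closure, which therefore misses the open arc.\<close>

lemma faces_at_arc:
  assumes "D \<in> components (- (L \<union> A))" "closure D \<inter> g ` {0<..<1} \<noteq> {}"
  shows "D \<in> components (face - A)"
proof (rule ccontr)
  assume "\<not> ?thesis"
  then have "D \<in> components (- L)" "D \<noteq> face" using assms(1) components_Compl_Un by auto
  then have "D \<inter> face = {}" using components_nonoverlap face_component by blast
  then have "closure D \<inter> face = {}" using open_face open_Int_closure_eq_empty by blast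
  then show False using assms(2) interior_in_face by blast
qed

section \<open>Change of the numbers of faces and components\<close>

lemma card_Compl_components_distinct:
  assumes "finite (components L)" and C: "C \<in> components L" "g 0 \<in> C" "g 1 \<notin> C"
    and fin: "finite (components (- L))"
  shows "finite (components (- (L \<union> A)))" "card (components (- (L \<union> A))) = card (components (- L))"
proof -
  have eq: "components (- (L \<union> A)) = insert (face - A) (components (- L) - {face})"
    using components_face_Diff_arc_distinct[OF assms(1) C] components_Compl_Un by auto
  have "face - A \<notin> components (- L) - {face}"
    using components_nonoverlap[OF _ face_component, of "face - A"] face_Diff_A_nonempty by blast
  then show "finite (components (- (L \<union> A)))"
    "card (components (- (L \<union> A))) = card (components (- L))"
    unfolding eq using fin face_component card_Suc_Diff1[OF fin face_component] by auto
qed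

text \<open>The Jordan curve theorem yields at least two pieces and Janiszewski's theorem at most
  two, so exactly one face is gained.\<close>

lemma card_Compl_components_same:
  assumes "finite (components L)" and C: "C \<in> components L" "path_connected C" "g 0 \<in> C" "g 1 \<in> C"
    and fin: "finite (components (- L))"
  shows "finite (components (- (L \<union> A)))" "card (components (- (L \<union> A))) = Suc (card (components (- L)))"
proof -
  have pieces: "finite (components (face - A))" "card (components (face - A)) = 2"
  proof -
    show f: "finite (components (face - A))" using card_pieces_le_2[OF assms(1)] by simp
    have "\<not> connected (face - A)"
      using C in_components_subset by (intro not_connected_face_Diff_arc) auto
    then have "\<not> components (face - A) \<subseteq> {D}" for D
      by (auto simp: connected_eq_components_subset_sing_exists)
    then have "\<not> card (components (face - A)) \<le> 1"
      using f by (metis card_le_Suc0_iff_eq One_nat_def subsetI singletonI insert_iff)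
    then show "card (components (face - A)) = 2"
      using card_pieces_le_2[OF assms(1)] by linarith
  qed
  have "(components (- L) - {face}) \<inter> components (face - A) = {}"
  proof -
    have False if "D \<in> components (- L)" "D \<noteq> face" "D \<in> components (face - A)" for D
      using that components_nonoverlap[OF that(1) face_component] in_components_subset[OF that(3)]
        in_components_nonempty[OF that(3)] by blast
    then show ?thesis by blast
  qed
  then show "finite (components (- (L \<union> A)))"
    "card (components (- (L \<union> A))) = Suc (card (components (- L)))"
    unfolding components_Compl_Un
    using pieces fin card_Suc_Diff1[OF fin face_component] by (auto simp: card_Un_disjoint)
qed

lemma components_Un_arc:
  assumes fin: "finite (components L)"
    and C: "C0 \<in> components L" "g 0 \<in> C0" "C1 \<in> components L" "g 1 \<in> C1"
  shows "components (L \<union> A) = insert (C0 \<union> A \<union> C1) (components L - {C0, C1})"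
proof (rule components_finite_closed_eqI)
  have g: "g 0 \<in> A" "g 1 \<in> A" by (auto simp: path_image_def)
  show "finite (insert (C0 \<union> A \<union> C1) (components L - {C0, C1}))" using fin by auto
  fix D assume D: "D \<in> insert (C0 \<union> A \<union> C1) (components L - {C0, C1})"
  have "connected (C0 \<union> A \<union> C1)"
    using C g in_components_connected connected_arc_image[OF arc_g] by (intro connected_Un) auto
  then show "D \<noteq> {} \<and> connected D \<and> closed D"
    using D C closed_components[OF closed_L] in_components_nonempty in_components_connected closed_A
    by auto
next
  have "disjnt (C0 \<union> A \<union> C1) D" if D: "D \<in> components L - {C0, C1}" for D
  proof -
    have "D \<inter> C0 = {}" "D \<inter> C1 = {}" "D \<subseteq> L"
      using D components_nonoverlap[of D L C0] components_nonoverlap[of D L C1] C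
        in_components_subset[of D L] by auto
    moreover from this have "D \<inter> A \<subseteq> {g 0, g 1} \<inter> D"
      using meets unfolding pathstart_def pathfinish_def by blast
    ultimately show ?thesis using C by (auto simp: disjnt_def)
  qed
  moreover have "pairwise disjnt (components L - {C0, C1})"
    using pairwise_disjoint_components[of L] unfolding pairwise_def disjnt_def by blast
  ultimately show "pairwise disjnt (insert (C0 \<union> A \<union> C1) (components L - {C0, C1}))"
    by (simp add: pairwise_insert disjnt_sym)
  have "L = \<Union>(components L - {C0, C1}) \<union> C0 \<union> C1"
    using Union_components[of L] C(1,3) by blast
  then show "\<Union>(insert (C0 \<union> A \<union> C1) (components L - {C0, C1})) = L \<union> A" by blast
qed

text \<open>The term \<open>card {C0, C1}\<close> treats both cases at once: it is 1 if one
  component absorbs the arc and 2 if two are merged.\<close>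

lemma card_components_Un_arc:
  assumes fin: "finite (components L)"
    and C: "C0 \<in> components L" "g 0 \<in> C0" "C1 \<in> components L" "g 1 \<in> C1"
  shows "finite (components (L \<union> A))" "card (components (L \<union> A)) + card {C0, C1} = Suc (card (components L))"
proof -
  have "C0 \<union> A \<union> C1 \<notin> components L"
  proof
    assume "C0 \<union> A \<union> C1 \<in> components L"
    then have "A \<subseteq> L" using in_components_subset by blast
    moreover have "g (1/2) \<in> A" by (auto simp: path_image_def)
    ultimately show False using g_in_L_iff[of "1/2"] by auto
  qed
  moreover have "card (components L - {C0, C1}) + card {C0, C1} = card (components L)"
    using C fin by (metis card_Diff_subset card_mono empty_subsetI finite.emptyI finite.insertI insert_subset le_add_diff_inverse2)
  ultimately show "finite (components (L \<union> A))"
    "card (components (L \<union> A)) + card {C0, C1} = Suc (card (components L))"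
    unfolding components_Un_arc[OF assms] using fin by auto
qed

text \<open>Preserves the invariant under which \<open>card_Compl_components_same\<close> can be
  used for the next arc.\<close>

lemma path_connected_components_Un_arc:
  assumes fin: "finite (components L)" and pc: "\<And>C. C \<in> components L \<Longrightarrow> path_connected C"
    and D: "D \<in> components (L \<union> A)"
  shows "path_connected D"
proof -
  obtain C0 C1 where C: "C0 \<in> components L" "g 0 \<in> C0" "C1 \<in> components L" "g 1 \<in> C1"
    using ends_L Union_components by (metis UnionE)
  have g: "g 0 \<in> A" "g 1 \<in> A" by (auto simp: path_image_def)
  have "path_connected (C0 \<union> A \<union> C1)"
    using C g pc arc_g by (intro path_connected_Un path_connected_path_image arc_imp_path) auto
  then show ?thesis using D pc components_Un_arc[OF fin C] by auto
qed

end

section \<open>Plane graphs\<close>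

definition arc_union :: "complex set \<Rightarrow> 'e set \<Rightarrow> ('e \<Rightarrow> real \<Rightarrow> complex) \<Rightarrow> complex set" where
  "arc_union W S \<gamma> = W \<union> (\<Union>e\<in>S. path_image (\<gamma> e))"

text \<open>Edges are indices, so parallel arcs are allowed here; where they must be excluded, the
  map from edges to end pairs is assumed injective.\<close>

definition plane_arcs :: "complex set \<Rightarrow> 'e set \<Rightarrow> ('e \<Rightarrow> real \<Rightarrow> complex) \<Rightarrow> bool" where
  "plane_arcs W S \<gamma> \<longleftrightarrow> finite W \<and> finite S \<and>
    (\<forall>e\<in>S. arc (\<gamma> e) \<and> path_image (\<gamma> e) \<inter> W = {pathstart (\<gamma> e), pathfinish (\<gamma> e)}) \<and>
    (\<forall>e\<in>S. \<forall>f\<in>S. e \<noteq> f \<longrightarrow> arc_interior (\<gamma> e) \<inter> arc_interior (\<gamma> f) = {})"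

lemma arc_interior_eq:
  assumes "arc g" shows "arc_interior g = g ` {0<..<1}"
  using assms simple_path_endless[of g] by (simp add: arc_interior_def arc_imp_simple_path)

lemma plane_arcs_subset:
  "plane_arcs W S \<gamma> \<Longrightarrow> T \<subseteq> S \<Longrightarrow> plane_arcs W T \<gamma>"
  unfolding plane_arcs_def by (meson finite_subset subsetD)

lemma compact_arc_union:
  "plane_arcs W S \<gamma> \<Longrightarrow> compact (arc_union W S \<gamma>)"
  unfolding plane_arcs_def arc_union_def
  by (intro compact_Un compact_UN) (auto intro: finite_imp_compact compact_arc_image)

text \<open>Any edge may be regarded as the last one attached.\<close>

lemma plane_arcs_attachment:
  assumes P: "plane_arcs W S \<gamma>" and e: "e \<in> S" "T \<subseteq> S - {e}"
  shows "arc_attachment (arc_union W T \<gamma>) (\<gamma> e)"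
proof
  show "compact (arc_union W T \<gamma>)"
    using plane_arcs_subset[OF P] e compact_arc_union by blast
  show "arc (\<gamma> e)" using P e by (auto simp: plane_arcs_def)
  have ends: "path_image (\<gamma> e) \<inter> W = {pathstart (\<gamma> e), pathfinish (\<gamma> e)}"
    using P e by (auto simp: plane_arcs_def)
  have "x \<in> {pathstart (\<gamma> e), pathfinish (\<gamma> e)}"
    if x: "x \<in> path_image (\<gamma> e)" "x \<in> path_image (\<gamma> f)" "f \<in> T" for x f
  proof (cases "x \<in> W")
    case False
    have f: "f \<in> S" "e \<noteq> f" using that e by auto
    have "x \<in> arc_interior (\<gamma> f)"
      using P f x False by (auto simp: plane_arcs_def arc_interior_def)
    moreover have "arc_interior (\<gamma> e) \<inter> arc_interior (\<gamma> f) = {}"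
      using P e f unfolding plane_arcs_def by blast
    ultimately show ?thesis using x by (auto simp: arc_interior_def)
  qed (use ends x in auto)
  then show "path_image (\<gamma> e) \<inter> arc_union W T \<gamma> = {pathstart (\<gamma> e), pathfinish (\<gamma> e)}"
    using ends unfolding arc_union_def by blast
qed

lemma connected_Compl_finite:
  fixes W :: "complex set"
  assumes "finite W" shows "connected (- W)"
  using assms
  by (intro path_connected_imp_connected path_connected_complement_countable) (auto simp: countable_finite)

lemma Compl_compact_nonempty:
  fixes K :: "complex set"
  assumes "compact K" shows "- K \<noteq> {}"
  using compact_imp_bounded[OF assms] not_bounded_UNIV by (metis double_complement Compl_empty_eq)

lemma components_finite_set:
  fixes W :: "'a::t1_space set"
  assumes "finite W" shows "components W = (\<lambda>x. {x}) ` W"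
  by (rule components_finite_closed_eqI) (use assms in \<open>auto simp: pairwise_def disjnt_def\<close>)

text \<open>Induction on the edges, starting from isolated points with one face. A new edge merges
  two components and keeps the number of faces, or stays in one component and adds a face.
  Finiteness and path-connectedness are carried along for the attachment lemmas.\<close>

lemma Euler_formula_aux:
  assumes P: "plane_arcs W S \<gamma>"
  shows "finite (components (arc_union W S \<gamma>)) \<and>
    (\<forall>C\<in>components (arc_union W S \<gamma>). path_connected C) \<and>
    finite (components (- arc_union W S \<gamma>)) \<and>
    card (components (- arc_union W S \<gamma>)) + card W = card S + 1 + card (components (arc_union W S \<gamma>))"
proof -
  have "finite S" "finite W" using P by (auto simp: plane_arcs_def)
  from \<open>finite S\<close> P show ?thesis
  proof (induction S rule: finite_induct)
    case empty
    have "components (- W) = {- W}"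
      using connected_Compl_finite[OF \<open>finite W\<close>] Compl_compact_nonempty[of W] \<open>finite W\<close>
      by (simp add: components_eq_sing_iff finite_imp_compact)
    then show ?case using \<open>finite W\<close>
      by (auto simp: arc_union_def components_finite_set card_image)
  next
    case (insert e S)
    let ?L = "arc_union W S \<gamma>" and ?g = "\<gamma> e"
    interpret arc_attachment ?L ?g
      by (rule plane_arcs_attachment[OF insert.prems]) (use insert.hyps in auto)
    have "plane_arcs W S \<gamma>" using plane_arcs_subset[OF insert.prems] by auto
    note IH = insert.IH[OF this]
    have eq: "arc_union W (insert e S) \<gamma> = ?L \<union> A" by (auto simp: arc_union_def)
    have finL: "finite (components ?L)" using IH by blast
    obtain C0 C1 where C: "C0 \<in> components ?L" "?g 0 \<in> C0" "C1 \<in> components ?L" "?g 1 \<in> C1"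
      using ends_L Union_components by (metis UnionE)
    note comps = card_components_Un_arc[OF finL C]
    have pc: "\<forall>C\<in>components (?L \<union> A). path_connected C"
      using path_connected_components_Un_arc[OF finL] IH by blast
    show ?case
    proof (cases "C0 = C1")
      case True
      then show ?thesis unfolding eq
        using pc comps IH card_Compl_components_same[OF finL C(1) _ C(2), simplified] C insert.hyps by auto
    next
      case False
      then have "?g 1 \<notin> C0" using C components_nonoverlap by blast
      then show ?thesis unfolding eq
        using pc comps IH card_Compl_components_distinct[OF finL C(1,2)] False insert.hyps by auto
    qed
  qed
qed

lemmas finite_components_arc_union = Euler_formula_aux[THEN conjunct1]
  and finite_faces_arc_union = Euler_formula_aux[THEN conjunct2, THEN conjunct2, THEN conjunct1]
  and Euler_formula = Euler_formula_aux[THEN conjunct2, THEN conjunct2, THEN conjunct2]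

section \<open>Components of the frontiers of faces\<close>

lemma (in arc_attachment) frontier_face_Diff_arc: "frontier (face - A) = frontier face \<union> A"
proof -
  obtain D where D: "D \<in> components (face - A)" using face_Diff_A_nonempty by (metis components_eq_empty ex_in_conv)
  \<comment> \<open>Removing the arc does not shrink the closure of the face; it only moves the arc
    to the frontier.\<close>
  then have A: "A \<subseteq> closure (face - A)"
    using arc_subset_closure_piece[OF D] in_components_subset[OF D] closure_mono by blast
  then have "face \<subseteq> closure (face - A)" using closure_subset[of "face - A"] by blast
  then have "closure (face - A) = closure face"
    by (meson Diff_subset closed_closure closure_minimal closure_mono subset_antisym)
  moreover have "open (face - A)" using open_face closed_A by auto
  ultimately show ?thesis
    using A open_face by (auto simp: frontier_def interior_open)
qed

text \<open>Makes the component count for attached arcs available for the frontier of the face as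
  well as for \<open>L\<close>.\<close>

lemma (in arc_attachment) arc_attachment_frontier: "arc_attachment (frontier face) g"
proof
  have sub: "frontier face \<subseteq> L"
    using frontier_of_components_closed_complement[OF closed_L face_component] .
  then show "compact (frontier face)"
    using compact_L frontier_closed by (metis compact_Int_closed inf.absorb_iff2)
  show "arc g" by (rule arc_g)
  have "A \<subseteq> closure face"
    using frontier_face_Diff_arc closure_mono[of "face - A" face] by (auto simp: frontier_def)
  then have "{g 0, g 1} \<subseteq> frontier face"
    using ends_L face_disjoint_L open_face by (auto simp: frontier_def interior_open path_image_def)
  then show "A \<inter> frontier face = {pathstart g, pathfinish g}"
    using meets sub by (auto simp: pathstart_def pathfinish_def)
qed

text \<open>Take a shortest segment between \<open>C\<close> and the rest of \<open>K\<close>: an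
  inner point lying in \<open>K\<close> would give a shorter distance between the two parts.\<close>

lemma compact_disconnected_bridge:
  fixes K :: "complex set"
  assumes "compact K" "finite (components K)" "C \<in> components K" "C \<noteq> K"
  obtains x y where "x \<in> C" "y \<in> K - C" "arc_attachment K (linepath x y)"
proof -
  have CK: "C \<subseteq> K" "C \<noteq> {}" using assms in_components_subset in_components_nonempty by blast+
  have cK: "closed K" using assms compact_imp_closed by blast
  have "K - C = \<Union>(components K - {C})" using assms in_components_unions_complement by blast
  then have "closed (K - C)" using assms closed_components[OF cK] by auto
  moreover have "compact C" "closed C" using assms compact_components closed_components[OF cK] by auto
  ultimately obtain x y where xy: "x \<in> C" "y \<in> K - C" "dist x y = setdist C (K - C)"
    using setdist_compact_closed[of C "K - C"] CK assms by (metis Diff_eq_empty_iff subset_antisym)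
  have "x \<noteq> y" using xy by auto
  have "closed_segment x y \<inter> K = {x, y}"
  proof -
    have "z \<notin> K" if z: "z \<in> open_segment x y" for z
    proof
      assume "z \<in> K"
      have lt: "dist z x < dist x y" "dist z y < dist x y"
        using dist_in_open_segment[OF z] by (auto simp: dist_commute)
      show False
      proof (cases "z \<in> C")
        case True
        then show False using setdist_le_dist[of z C y "K - C"] xy lt by auto
      next
        case False
        then show False using setdist_le_dist[of x C z "K - C"] xy lt \<open>z \<in> K\<close> by (auto simp: dist_commute)
      qed
    qed
    then show ?thesis using xy CK by (auto simp: open_segment_def)
  qed
  then have "arc_attachment K (linepath x y)"
    using assms \<open>x \<noteq> y\<close> by unfold_locales auto
  then show thesis using that xy by blast
qed

text \<open>
  Induction on the number of components: a shortest segment between two components merges them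
  without changing the number of faces, and lowers the left-hand side by at most one.
\<close>

lemma sum_frontier_components:
  fixes K :: "complex set"
  assumes "compact K" "K \<noteq> {}" "finite (components K)" "finite (components (- K))"
    and "\<And>f. f \<in> components (- K) \<Longrightarrow> finite (components (frontier f))"
  shows "(\<Sum>f\<in>components (- K). card (components (frontier f))) + 1
    \<le> card (components (- K)) + card (components K)"
  using assms
proof (induction "card (components K)" arbitrary: K rule: less_induct)
  case less
  obtain C where C: "C \<in> components K" using less.prems(2) by (metis components_eq_empty ex_in_conv)
  show ?case
  proof (cases "C = K")
    case True
    then have conn: "connected K" using C in_components_connected by blast
    have "card (components (frontier f)) \<le> 1" if "f \<in> components (- K)" for f
    proof -
      have "components (frontier f) \<subseteq> {frontier f}"
        using connected_frontier_component_complement[OF conn that] connected_eq_components_subset_sing by blast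
      then show ?thesis using card_mono[of "{frontier f}"] by auto
    qed
    then have "(\<Sum>f\<in>components (- K). card (components (frontier f))) \<le> card (components (- K))"
      using sum_bounded_above[of "components (- K)" "\<lambda>f. card (components (frontier f))" 1] by simp
    moreover have "card (components K) \<ge> 1"
      using less.prems by (simp add: Suc_le_eq card_gt_0_iff)
    ultimately show ?thesis by linarith
  next
    case False
    then obtain x y where xy: "x \<in> C" "y \<in> K - C" "arc_attachment K (linepath x y)"
      using compact_disconnected_bridge[OF less.prems(1,3) C] by blast
    interpret arc_attachment K "linepath x y" by (rule xy(3))
    interpret fr: arc_attachment "frontier face" "linepath x y" by (rule arc_attachment_frontier)
    have x: "linepath x y 0 \<in> C" "linepath x y 1 \<notin> C" using xy by (auto simp: linepath_def)
    obtain C1 where C1: "C1 \<in> components K" "linepath x y 1 \<in> C1" using ends_L Union_components by blast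
    have ne: "C \<noteq> C1" using C1 x by blast
    have compsU: "finite (components (K \<union> A))" "card (components (K \<union> A)) + 1 = card (components K)"
      using card_components_Un_arc[OF less.prems(3) C x(1) C1] ne by auto
    have faces: "components (- (K \<union> A)) = insert (face - A) (components (- K) - {face})"
      using components_face_Diff_arc_distinct[OF less.prems(3) C x] components_Compl_Un by auto
    have nin: "face - A \<notin> components (- K) - {face}"
      using components_nonoverlap[OF _ face_component, of "face - A"] face_Diff_A_nonempty by blast
    have F: "finite (components (- (K \<union> A)))" "card (components (- (K \<union> A))) = card (components (- K))"
      using card_Compl_components_distinct[OF less.prems(3) C x less.prems(4)] by auto
    have finfr: "finite (components (frontier face))" using less.prems(5) face_component by blast
    obtain B0 B1 where B: "B0 \<in> components (frontier face)" "linepath x y 0 \<in> B0"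
        "B1 \<in> components (frontier face)" "linepath x y 1 \<in> B1"
      using fr.ends_L Union_components by (metis UnionE)
    note cfr = fr.card_components_Un_arc[OF finfr B]
    \<comment> \<open>The bridge joins at most two components of the frontier, so the term of
      \<open>face\<close> falls by at most one, while the right-hand side falls by exactly
      one.\<close>
    have "card {B0, B1} \<le> 2" by (cases "B0 = B1") auto
    then have old: "card (components (frontier face)) \<le> card (components (frontier (face - A))) + 1"
      using cfr unfolding frontier_face_Diff_arc by linarith
    have "(\<Sum>f\<in>components (- (K \<union> A)). card (components (frontier f))) + 1
        \<le> card (components (- (K \<union> A))) + card (components (K \<union> A))"
    proof (rule less.hyps)
      show "card (components (K \<union> A)) < card (components K)" using compsU by simp
      show "compact (K \<union> A)" using compact_A less.prems by auto
      show "finite (components (frontier f))" if "f \<in> components (- (K \<union> A))" for f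
        using that less.prems(5) cfr(1) frontier_face_Diff_arc faces by auto
    qed (use compsU F less.prems in auto)
    moreover have "(\<Sum>f\<in>components (- (K \<union> A)). card (components (frontier f)))
        = card (components (frontier (face - A))) + (\<Sum>f\<in>components (- K) - {face}. card (components (frontier f)))"
      unfolding faces using nin less.prems(4) by simp
    moreover have "(\<Sum>f\<in>components (- K). card (components (frontier f)))
        = card (components (frontier face)) + (\<Sum>f\<in>components (- K) - {face}. card (components (frontier f)))"
      using sum.remove[OF less.prems(4) face_component] .
    ultimately show ?thesis using old compsU F by linarith
  qed
qed

section \<open>Faces and their incident vertices and edges\<close>

locale plane_graph =
  fixes W :: "complex set" and S :: "'e set" and \<gamma> :: "'e \<Rightarrow> real \<Rightarrow> complex"
  assumes plane: "plane_arcs W S \<gamma>"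
begin

abbreviation K :: "complex set" where "K \<equiv> arc_union W S \<gamma>"

definition face_verts :: "complex set \<Rightarrow> complex set" where
  "face_verts f = W \<inter> closure f"

text \<open>A single interior point suffices for incidence: for a face the whole edge then lies in
  the closure (\<open>face_edge_subset_closure\<close>).\<close>

definition face_edges :: "complex set \<Rightarrow> 'e set" where
  "face_edges f = {e \<in> S. arc_interior (\<gamma> e) \<inter> closure f \<noteq> {}}"

lemma finite_W: "finite W" and finite_S: "finite S" using plane by (auto simp: plane_arcs_def)

lemma finite_face_verts: "finite (face_verts f)" and finite_face_edges: "finite (face_edges f)"
  using finite_W finite_S by (auto simp: face_verts_def face_edges_def)

lemma closed_K: "closed K" using compact_arc_union[OF plane] compact_imp_closed by blast

lemma edge_attachment: "e \<in> S \<Longrightarrow> arc_attachment (arc_union W (S - {e}) \<gamma>) (\<gamma> e)"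
  by (rule plane_arcs_attachment[OF plane]) auto

lemma edge_Un: "e \<in> S \<Longrightarrow> K = arc_union W (S - {e}) \<gamma> \<union> path_image (\<gamma> e)"
  by (auto simp: arc_union_def)

text \<open>With \<open>e\<close> attached last, the faces at \<open>e\<close> are among the pieces
  that \<open>e\<close> cuts out. The bound of two faces per edge comes from here.\<close>

lemma face_edge_piece:
  assumes f: "f \<in> components (- K)" and e: "e \<in> face_edges f"
  shows "f \<in> components (arc_attachment.face (arc_union W (S - {e}) \<gamma>) (\<gamma> e) - path_image (\<gamma> e))"
proof -
  have eS: "e \<in> S" using e by (simp add: face_edges_def)
  interpret arc_attachment "arc_union W (S - {e}) \<gamma>" "\<gamma> e" using edge_attachment[OF eS] .
  show ?thesis
    using faces_at_arc f e arc_interior_eq[OF arc_g] edge_Un[OF eS] by (auto simp: face_edges_def Int_commute)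
qed

lemma face_edge_subset_closure:
  assumes f: "f \<in> components (- K)" and e: "e \<in> face_edges f"
  shows "path_image (\<gamma> e) \<subseteq> closure f"
proof -
  have eS: "e \<in> S" using e by (simp add: face_edges_def)
  interpret arc_attachment "arc_union W (S - {e}) \<gamma>" "\<gamma> e" using edge_attachment[OF eS] .
  show ?thesis using arc_subset_closure_piece face_edge_piece[OF f e] by blast
qed

lemma finite_faces: "finite (components (- K))"
  by (rule finite_faces_arc_union[OF plane])

lemma card_faces_at_edge:
  assumes e: "e \<in> S"
  shows "card {f \<in> components (- K). e \<in> face_edges f} \<le> 2"
proof -
  interpret arc_attachment "arc_union W (S - {e}) \<gamma>" "\<gamma> e" using edge_attachment[OF e] .
  have "finite (components (arc_union W (S - {e}) \<gamma>))"
    by (rule finite_components_arc_union[OF plane_arcs_subset[OF plane]]) auto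
  note le = card_pieces_le_2[OF this]
  have "{f \<in> components (- K). e \<in> face_edges f} \<subseteq> components (face - A)"
    using face_edge_piece by blast
  then show ?thesis using le card_mono by (meson order_trans)
qed

lemma sum_card_face_edges: "(\<Sum>f\<in>components (- K). card (face_edges f)) \<le> 2 * card S"
proof -
  have "(\<Sum>f\<in>components (- K). card (face_edges f))
      = (\<Sum>f\<in>components (- K). \<Sum>e\<in>S. if e \<in> face_edges f then 1 else 0)"
  proof (rule sum.cong[OF refl])
    fix f
    have "face_edges f = {e \<in> S. e \<in> face_edges f}" by (auto simp: face_edges_def)
    then show "card (face_edges f) = (\<Sum>e\<in>S. if e \<in> face_edges f then 1 else 0)"
      using finite_S by (simp flip: sum.inter_filter)
  qed
  also have "\<dots> = (\<Sum>e\<in>S. \<Sum>f\<in>components (- K). if e \<in> face_edges f then 1 else 0)"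
    by (rule sum.swap)
  also have "\<dots> = (\<Sum>e\<in>S. card {f \<in> components (- K). e \<in> face_edges f})"
    using finite_faces by (simp flip: sum.inter_filter)
  also have "\<dots> \<le> card S * 2"
    using sum_bounded_above[of S "\<lambda>e. card {f \<in> components (- K). e \<in> face_edges f}" 2] card_faces_at_edge by simp
  finally show ?thesis by simp
qed

lemma face_edge_ends:
  assumes f: "f \<in> components (- K)" and e: "e \<in> face_edges f"
  shows "path_image (\<gamma> e) \<inter> face_verts f = {pathstart (\<gamma> e), pathfinish (\<gamma> e)}"
proof -
  have "path_image (\<gamma> e) \<inter> W = {pathstart (\<gamma> e), pathfinish (\<gamma> e)}"
    using plane e by (auto simp: plane_arcs_def face_edges_def)
  then show ?thesis using face_edge_subset_closure[OF f e] by (auto simp: face_verts_def)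
qed

text \<open>With \<open>frontier_face\<close>, this makes the frontier a plane graph to which
  Euler's formula applies.\<close>

lemma plane_arcs_frontier:
  assumes "f \<in> components (- K)"
  shows "plane_arcs (face_verts f) (face_edges f) \<gamma>"
  using plane finite_face_verts finite_face_edges face_edge_ends[OF assms]
  unfolding plane_arcs_def by (auto simp: face_edges_def)

lemma frontier_face:
  assumes f: "f \<in> components (- K)"
  shows "frontier f = arc_union (face_verts f) (face_edges f) \<gamma>"
proof
  have op: "open f" using f closed_K open_components by blast
  have fK: "f \<inter> K = {}" using f in_components_subset by blast
  have sub: "frontier f \<subseteq> K" by (rule frontier_of_components_closed_complement[OF closed_K f])
  show "frontier f \<subseteq> arc_union (face_verts f) (face_edges f) \<gamma>"
  proof
    fix x assume x: "x \<in> frontier f"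
    then have cl: "x \<in> closure f" by (simp add: frontier_def)
    show "x \<in> arc_union (face_verts f) (face_edges f) \<gamma>"
    proof (cases "x \<in> W")
      case True
      then show ?thesis using cl by (auto simp: arc_union_def face_verts_def)
    next
      case False
      then obtain e where e: "e \<in> S" "x \<in> path_image (\<gamma> e)" using x sub by (auto simp: arc_union_def)
      then have "x \<in> arc_interior (\<gamma> e)"
        using plane False by (auto simp: plane_arcs_def arc_interior_def)
      then have "e \<in> face_edges f" using e cl by (auto simp: face_edges_def)
      then show ?thesis using e by (auto simp: arc_union_def)
    qed
  qed
  have "arc_union (face_verts f) (face_edges f) \<gamma> \<subseteq> closure f"
    using face_edge_subset_closure[OF f] by (auto simp: arc_union_def face_verts_def)
  moreover have "arc_union (face_verts f) (face_edges f) \<gamma> \<subseteq> K"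
    by (auto simp: arc_union_def face_verts_def face_edges_def)
  ultimately show "arc_union (face_verts f) (face_edges f) \<gamma> \<subseteq> frontier f"
    using op fK by (auto simp: frontier_def interior_open)
qed

text \<open>A second face is open and disjoint from \<open>f\<close>, so it misses the closure of
  \<open>f\<close>. Hence \<open>f\<close> and the complement of its closure are two nonempty open
  parts.\<close>

lemma not_connected_Compl_frontier:
  assumes f: "f \<in> components (- K)" and nc: "\<not> connected (- K)"
  shows "\<not> connected (- frontier f)"
proof
  assume con: "connected (- frontier f)"
  have op: "open f" and fne: "f \<noteq> {}" using f closed_K open_components in_components_nonempty by blast+
  obtain f' where f': "f' \<in> components (- K)" "f' \<noteq> f"
    using nc f connected_eq_connected_components_eq by metis
  then have op': "open f'" and ne': "f' \<noteq> {}" and dis: "f' \<inter> f = {}"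
    using f closed_K open_components in_components_nonempty components_nonoverlap by blast+
  then have "f' \<inter> closure f = {}" using open_Int_closure_eq_empty by blast
  moreover have "f \<inter> frontier f = {}" using op frontier_disjoint_eq[of f] by blast
  moreover have "- frontier f \<subseteq> f \<union> - closure f" using op by (auto simp: frontier_def interior_open)
  moreover have "frontier f \<subseteq> closure f" by (simp add: frontier_def)
  moreover have "f \<inter> - closure f = {}" using closure_subset by blast
  ultimately show False
    using connectedD[OF con op, of "- closure f"] fne ne' by blast
qed

text \<open>Euler's formula for the frontier, whose complement has at least two components.\<close>

lemma face_Euler:
  assumes f: "f \<in> components (- K)" and nc: "\<not> connected (- K)"
  shows "card (face_verts f) + 1 \<le> card (face_edges f) + card (components (frontier f))"
proof -
  let ?F = "components (- frontier f)"
  have fin: "finite ?F" using finite_faces_arc_union[OF plane_arcs_frontier[OF f]] frontier_face[OF f] by simp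
  have "\<not> card ?F \<le> 1"
  proof
    assume "card ?F \<le> 1"
    then have "\<forall>C\<in>?F. \<forall>D\<in>?F. C = D" using fin by (simp add: card_le_Suc0_iff_eq)
    then show False
      using not_connected_Compl_frontier[OF assms] connected_eq_connected_components_eq by blast
  qed
  then show ?thesis using Euler_formula[OF plane_arcs_frontier[OF f]] frontier_face[OF f] by simp
qed

text \<open>With at most two vertices, all edges on the frontier have the same ends, so there is at
  most one. A finite set or a single arc does not separate the plane.\<close>

lemma card_face_verts_ge_3:
  assumes f: "f \<in> components (- K)" and nc: "\<not> connected (- K)"
    and inj: "inj_on (\<lambda>e. {pathstart (\<gamma> e), pathfinish (\<gamma> e)}) S"
  shows "card (face_verts f) \<ge> 3"
proof (rule ccontr)
  assume "\<not> ?thesis"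
  then have le: "card (face_verts f) \<le> 2" by simp
  have ends: "{pathstart (\<gamma> e), pathfinish (\<gamma> e)} = face_verts f" if e: "e \<in> face_edges f" for e
  proof (rule card_seteq)
    show "{pathstart (\<gamma> e), pathfinish (\<gamma> e)} \<subseteq> face_verts f" using face_edge_ends[OF f e] by blast
    have "pathstart (\<gamma> e) \<noteq> pathfinish (\<gamma> e)"
      using plane e unfolding plane_arcs_def face_edges_def by (metis (no_types, lifting) arc_distinct_ends mem_Collect_eq)
    then show "card (face_verts f) \<le> card {pathstart (\<gamma> e), pathfinish (\<gamma> e)}" using le by simp
  qed (rule finite_face_verts)
  have "connected (- frontier f)"
  proof (cases "face_edges f = {}")
    case True
    then show ?thesis
      using frontier_face[OF f] connected_Compl_finite[OF finite_face_verts] by (simp add: arc_union_def)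
  next
    case False
    then obtain e where e: "e \<in> face_edges f" by blast
    have "face_edges f = {e}"
    proof -
      have "e' = e" if "e' \<in> face_edges f" for e'
        using ends[OF that] ends[OF e] inj_onD[OF inj, of e' e] that e by (auto simp: face_edges_def)
      then show ?thesis using e by blast
    qed
    then have "frontier f = path_image (\<gamma> e)"
      using frontier_face[OF f] ends[OF e] face_edge_ends[OF f e] by (auto simp: arc_union_def)
    then show ?thesis
      using connected_arc_complement[of "\<gamma> e"] plane e by (auto simp: plane_arcs_def face_edges_def)
  qed
  then show False using not_connected_Compl_frontier[OF f nc] by blast
qed

end

section \<open>Counting edges\<close>

lemma sum_power2_le_power2_sum:
  fixes d :: "'i \<Rightarrow> real"
  assumes "finite I" "\<And>i. i \<in> I \<Longrightarrow> 0 \<le> d i"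
  shows "(\<Sum>i\<in>I. (d i)\<^sup>2) \<le> (\<Sum>i\<in>I. d i)\<^sup>2"
  using assms
proof (induction I rule: finite_induct)
  case (insert i I)
  have "0 \<le> d i * (\<Sum>i\<in>I. d i)" using insert.prems by (intro mult_nonneg_nonneg sum_nonneg) auto
  then show ?case using insert by (simp add: power2_sum)
qed simp

lemma real_choose_two: "real (n choose 2) = real n * (real n - 1) / 2"
proof -
  have "2 * (n choose 2) = n * (n - 1)"
    unfolding choose_two by (intro dvd_mult_div_cancel) (cases n, auto)
  then have "2 * real (n choose 2) = real n * real (n - 1)" by (metis of_nat_mult of_nat_numeral)
  then show ?thesis by (cases n) auto
qed

lemma real_card_Diff:
  assumes "finite A" "B \<subseteq> A"
  shows "real (card (A - B)) = real (card A) - real (card B)"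
  using assms by (simp add: card_Diff_subset card_mono finite_subset of_nat_diff)

text \<open>Settles the case of a single face and the nonnegativity of the final bound.\<close>

lemma sqrt_twice_card_pairs_le:
  assumes "finite W" "X \<subseteq> {x. x \<subseteq> W \<and> card x = 2}"
  shows "sqrt (2 * real (card X)) \<le> real (card W)"
proof (rule real_le_lsqrt)
  have "card X \<le> card {x. x \<subseteq> W \<and> card x = 2}"
    using assms by (intro card_mono) auto
  also have "\<dots> = card W choose 2" by (rule n_subsets[OF assms(1)])
  finally have "real (card X) \<le> real (card W) * (real (card W) - 1) / 2"
    by (simp flip: real_choose_two)
  then show "2 * real (card X) \<le> (real (card W))\<^sup>2" by (simp add: power2_eq_square algebra_simps)
qed simp

text \<open>\<open>X\<close> holds the end pairs of all edges of the drawn graph. Of the crossed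
  edges only the assumption \<open>faces\<close> is retained, which turns the rest into
  counting.\<close>

lemma (in plane_graph) uncrossed_bound:
  assumes inj: "inj_on (\<lambda>e. {pathstart (\<gamma> e), pathfinish (\<gamma> e)}) S"
    and X: "X \<subseteq> {x. x \<subseteq> W \<and> card x = 2}"
    and faces: "\<And>x. x \<in> X - (\<lambda>e. {pathstart (\<gamma> e), pathfinish (\<gamma> e)}) ` S \<Longrightarrow> \<exists>f\<in>components (- K). x \<subseteq> closure f"
    and n: "card W \<ge> 3"
  shows "sqrt (2 * real (card X)) \<le> 3 * real (card W) - 6 - real (card S) + sqrt (6 * (real (card W) - 2))"
proof -
  let ?ends = "\<lambda>e. {pathstart (\<gamma> e), pathfinish (\<gamma> e)}"
  define n s c F where "n = real (card W)" and "s = real (card S)"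
    and "c = real (card (components K))" and "F = real (card (components (- K)))"
  define r where "r = sqrt (6 * (n - 2))"
  have n3: "n \<ge> 3" using n by (simp add: n_def)
  have r2: "r ^ 2 = 6 * (n - 2)" using n3 by (simp add: r_def)
  have r: "r \<ge> 2" unfolding r_def using n3 by (intro real_le_rsqrt) simp
  have finK: "finite (components K)" by (rule finite_components_arc_union[OF plane])
  have Kne: "K \<noteq> {}" using n by (auto simp: arc_union_def)
  then have "card (components K) > 0" using finK by (simp add: card_gt_0_iff)
  then have c1: "c \<ge> 1" unfolding c_def by linarith
  have euler: "F + n = s + 1 + c"
    using Euler_formula[OF plane] unfolding F_def n_def s_def c_def by linarith
  show ?thesis
  proof (cases "connected (- K)")
    case True
    then have "components (- K) = {- K}"
      using Compl_compact_nonempty[OF compact_arc_union[OF plane]] by (simp add: components_eq_sing_iff)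
    then have "F = 1" by (simp add: F_def)
    \<comment> \<open>The right-hand side is then at least 2n - 5 + r, which is at least n because n
      >= 3 and r >= 2.\<close>
    then have "s \<le> n - 1" using euler c1 by linarith
    moreover have "sqrt (2 * real (card X)) \<le> n"
      unfolding n_def by (rule sqrt_twice_card_pairs_le[OF finite_W X])
    ultimately show ?thesis using r n3 unfolding n_def[symmetric] s_def[symmetric] r_def[symmetric]
      by linarith
  next
    case False
    define v e cf where "v f = real (card (face_verts f))" and "e f = real (card (face_edges f))"
      and "cf f = real (card (components (frontier f)))" for f
    define d where "d f = v f - 3" for f
    let ?F = "components (- K)"
    have d0: "d f \<ge> 0" if "f \<in> ?F" for f
      using card_face_verts_ge_3[OF that False inj] by (simp add: d_def v_def)
    have ve: "v f + 1 \<le> e f + cf f" if "f \<in> ?F" for f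
      using face_Euler[OF that False] unfolding v_def e_def cf_def by linarith
    have se: "(\<Sum>f\<in>?F. e f) \<le> 2 * s"
      using sum_card_face_edges unfolding e_def s_def of_nat_sum[symmetric] by linarith
    have "finite (components (frontier f))" if "f \<in> ?F" for f
      unfolding frontier_face[OF that] by (rule finite_components_arc_union[OF plane_arcs_frontier[OF that]])
    then have "(\<Sum>f\<in>?F. card (components (frontier f))) + 1 \<le> card ?F + card (components K)"
      by (intro sum_frontier_components compact_arc_union[OF plane] Kne finK finite_faces)
    then have scf: "(\<Sum>f\<in>?F. cf f) + 1 \<le> F + c"
      unfolding cf_def F_def c_def of_nat_sum[symmetric] by linarith
    define D where "D = (\<Sum>f\<in>?F. d f)"
    have sumv: "(\<Sum>f\<in>?F. v f) = D + 3 * F"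
      by (simp add: D_def d_def sum_subtractf F_def)
    have "(\<Sum>f\<in>?F. v f + 1) \<le> (\<Sum>f\<in>?F. e f + cf f)" using ve by (intro sum_mono) auto
    then have "D + 4 * F \<le> 2 * s + (F + c - 1)"
      using se scf sumv by (simp add: sum.distrib F_def)
    \<comment> \<open>The shortfall from the 3n - 6 edges of a triangulation. Substituting F = s + 1
      + c - n into the previous inequality bounds the total excess \<open>D\<close> by it.\<close>
    define k where "k = 3 * n - 6 - s"
    have Dk: "D \<le> k - (2 * c - 2)"
      using \<open>D + 4 * F \<le> 2 * s + (F + c - 1)\<close> euler unfolding k_def by linarith
    have D0: "D \<ge> 0" unfolding D_def using d0 by (intro sum_nonneg) auto
    \<comment> \<open>Candidates for crossed edges inside \<open>f\<close>. A pair may occur at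
      several faces, which only enlarges the upper bound.\<close>
    let ?P = "\<lambda>f. {x. x \<subseteq> face_verts f \<and> card x = 2} - ?ends ` face_edges f"
    have card_face: "real (card (?P f))
        \<le> ((d f)\<^sup>2 + 3 * d f) / 2 - 1 + cf f" if f: "f \<in> ?F" for f
    proof -
      have "?ends ` face_edges f \<subseteq> {x. x \<subseteq> face_verts f \<and> card x = 2}"
      proof
        fix x assume "x \<in> ?ends ` face_edges f"
        then obtain a where a: "a \<in> face_edges f" "x = ?ends a" by blast
        have "pathstart (\<gamma> a) \<noteq> pathfinish (\<gamma> a)"
          using plane a(1) unfolding plane_arcs_def face_edges_def
          by (metis (no_types, lifting) arc_distinct_ends mem_Collect_eq)
        then show "x \<in> {x. x \<subseteq> face_verts f \<and> card x = 2}"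
          using face_edge_ends[OF f a(1)] a(2) by auto
      qed
      then have "real (card (?P f)) = real (card {x. x \<subseteq> face_verts f \<and> card x = 2}) - real (card (?ends ` face_edges f))"
        by (intro real_card_Diff) (simp add: finite_face_verts)
      also have "card {x. x \<subseteq> face_verts f \<and> card x = 2} = card (face_verts f) choose 2"
        by (rule n_subsets[OF finite_face_verts])
      also have "card (?ends ` face_edges f) = card (face_edges f)"
        by (rule card_image, rule inj_on_subset[OF inj]) (auto simp: face_edges_def)
      also have "real (card (face_verts f) choose 2) - real (card (face_edges f)) = v f * (v f - 1) / 2 - e f"
        by (simp add: real_choose_two v_def e_def)
      also have "\<dots> \<le> v f * (v f - 1) / 2 - (v f + 1 - cf f)" using ve[OF f] by linarith
      also have "\<dots> = ((d f)\<^sup>2 + 3 * d f) / 2 - 1 + cf f"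
        by (simp add: d_def power2_eq_square field_simps)
      finally show ?thesis .
    qed
    have "X \<subseteq> ?ends ` S \<union> (\<Union>f\<in>?F. ?P f)"
    proof
      fix x assume x: "x \<in> X"
      show "x \<in> ?ends ` S \<union> (\<Union>f\<in>?F. ?P f)"
      proof (cases "x \<in> ?ends ` S")
        case False
        then obtain f where f: "f \<in> ?F" "x \<subseteq> closure f" using faces x by blast
        moreover have "x \<subseteq> W" "card x = 2" using X x by auto
        moreover have "x \<notin> ?ends ` face_edges f" using False by (auto simp: face_edges_def)
        ultimately have "x \<in> ?P f" by (auto simp: face_verts_def)
        then show ?thesis using f by blast
      qed simp
    qed
    then have "card X \<le> card (?ends ` S \<union> (\<Union>f\<in>?F. ?P f))"
      using finite_S finite_faces finite_face_verts by (intro card_mono) auto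
    also have "\<dots> \<le> card (?ends ` S) + card (\<Union>f\<in>?F. ?P f)" by (rule card_Un_le)
    also have "\<dots> \<le> card S + (\<Sum>f\<in>?F. card (?P f))"
      by (intro add_mono card_image_le finite_S card_UN_le finite_faces)
    finally have "real (card X) \<le> s + (\<Sum>f\<in>?F. real (card (?P f)))"
      unfolding s_def of_nat_sum[symmetric] by linarith
    also have "\<dots> \<le> s + (\<Sum>f\<in>?F. ((d f)\<^sup>2 + 3 * d f) / 2 - 1 + cf f)"
      using card_face by (intro add_left_mono sum_mono) auto
    also have "\<dots> = s + ((\<Sum>f\<in>?F. (d f)\<^sup>2) + 3 * D) / 2 - F + (\<Sum>f\<in>?F. cf f)"
      by (simp add: sum.distrib sum_subtractf D_def F_def sum_distrib_left sum_divide_distrib add_divide_distrib)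
    \<comment> \<open>The worst case has all excess in one face; \<open>scf\<close> bounds the
      frontier components minus F by c - 1.\<close>
    also have "\<dots> \<le> s + (D\<^sup>2 + 3 * D) / 2 + c - 1"
    proof -
      have "(\<Sum>f\<in>?F. (d f)\<^sup>2) \<le> D\<^sup>2"
        unfolding D_def using finite_faces d0 by (rule sum_power2_le_power2_sum)
      then show ?thesis using scf by argo
    qed
    finally have m: "2 * real (card X) \<le> 2 * s + D\<^sup>2 + 3 * D + 2 * c - 2" by argo
    have "D\<^sup>2 \<le> k\<^sup>2" using D0 Dk c1 by (intro power_mono) auto
    \<comment> \<open>The extra 2c - 2 is paid for by \<open>Dk\<close>, where three times that
      amount is saved.\<close>
    moreover have "3 * D + 2 * c - 2 \<le> 3 * k" using Dk c1 by linarith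
    moreover have "2 * s = r\<^sup>2 - 2 * k" unfolding r2 k_def by simp
    ultimately have "2 * real (card X) \<le> k\<^sup>2 + k + r\<^sup>2" using m by linarith
    also have "\<dots> \<le> (k + r)\<^sup>2"
    proof -
      have "k \<ge> 0" using D0 Dk c1 by linarith
      then have "k * 1 \<le> k * (2 * r)" using r by (intro mult_left_mono) auto
      then show ?thesis by (simp add: power2_sum)
    qed
    finally have "sqrt (2 * real (card X)) \<le> k + r"
      using D0 Dk c1 r by (intro real_le_lsqrt) auto
    then show ?thesis unfolding k_def r_def n_def s_def by simp
  qed
qed

text \<open>The interior of a crossed edge meets neither vertices nor uncrossed edges. Being
  connected, it lies in one face of the uncrossed graph, and by continuity its ends lie in the
  closure of that face.\<close>

lemma drawing_uncrossed_bound: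
  assumes G: "simple_graph V E" and D: "drawing V E p \<gamma>" and n: "card V \<ge> 3"
  shows "sqrt (2 * real (card E))
    \<le> 3 * real (card V) - 6 - real (card (uncrossed_edges E \<gamma>)) + sqrt (6 * (real (card V) - 2))"
proof -
  let ?H = "uncrossed_edges E \<gamma>" and ?ends = "\<lambda>e. {pathstart (\<gamma> e), pathfinish (\<gamma> e)}"
  have fin: "finite V" and E: "\<And>e. e \<in> E \<Longrightarrow> e \<subseteq> V \<and> card e = 2"
    using G by (auto simp: simple_graph_def)
  have finE: "finite E" using fin E by (meson PowI finite_Pow_iff finite_subset subsetI)
  have inj: "inj_on p V" using D by (simp add: drawing_def)
  have HE: "?H \<subseteq> E" by (auto simp: uncrossed_edges_def)
  have arc: "arc (\<gamma> e)" and ends: "?ends e = p ` e" and off: "path_image (\<gamma> e) \<inter> p ` (V - e) = {}"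
    if "e \<in> E" for e using D that by (auto simp: drawing_def)
  have verts: "path_image (\<gamma> e) \<inter> p ` V = ?ends e" if e: "e \<in> E" for e
  proof -
    have "p ` V = p ` e \<union> p ` (V - e)" using E[OF e] by blast
    moreover have "p ` e \<subseteq> path_image (\<gamma> e)" unfolding ends[OF e, symmetric] by (simp add: pathstart_in_path_image pathfinish_in_path_image)
    ultimately show ?thesis using off[OF e] unfolding ends[OF e] by (simp add: Int_Un_distrib inf.absorb2)
  qed
  interpret plane_graph "p ` V" ?H \<gamma>
  proof
    show "plane_arcs (p ` V) ?H \<gamma>"
      unfolding plane_arcs_def
    proof (intro conjI ballI impI)
      show "finite ?H" using finE HE finite_subset by blast
      show "arc_interior (\<gamma> e) \<inter> arc_interior (\<gamma> f) = {}" if "e \<in> ?H" "f \<in> ?H" "e \<noteq> f" for e f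
        using that by (auto simp: uncrossed_edges_def)
    qed (use fin arc verts HE in auto)
  qed
  have injE: "inj_on (\<lambda>e. p ` e) E"
    using inj_on_image[of p "{e. e \<subseteq> V}"] inj E
    by (intro inj_onI) (meson inj_on_image_eq_iff)
  then have inj_ends: "inj_on ?ends E" using ends by (simp cong: inj_on_cong)
  have "sqrt (2 * real (card (?ends ` E)))
    \<le> 3 * real (card (p ` V)) - 6 - real (card ?H) + sqrt (6 * (real (card (p ` V)) - 2))"
  proof (rule uncrossed_bound)
    show "inj_on ?ends ?H" using inj_ends HE inj_on_subset by blast
    show "?ends ` E \<subseteq> {x. x \<subseteq> p ` V \<and> card x = 2}"
    proof clarify
      fix e assume e: "e \<in> E"
      have "card (p ` e) = 2" using E[OF e] inj by (metis card_image inj_on_subset)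
      then show "?ends e \<subseteq> p ` V \<and> card (?ends e) = 2" unfolding ends[OF e] using E[OF e] by blast
    qed
    show "card (p ` V) \<ge> 3" using n inj by (simp add: card_image)
    fix x assume "x \<in> ?ends ` E - ?ends ` ?H"
    then obtain e where e: "e \<in> E" "e \<notin> ?H" and x: "x = ?ends e" by blast
    note int = arc_interior_eq[OF arc[OF e(1)]]
    have cont: "continuous_on {0..1} (\<gamma> e)" using arc[OF e(1)] by (simp add: arc_def path_def)
    have "arc_interior (\<gamma> e) \<inter> K = {}"
    proof -
      have "y \<notin> K" if y: "y \<in> arc_interior (\<gamma> e)" for y
      proof
        assume "y \<in> K"
        have yV: "y \<notin> p ` V" using y verts[OF e(1)] by (auto simp: arc_interior_def)
        then obtain h where h: "h \<in> ?H" "y \<in> path_image (\<gamma> h)" using \<open>y \<in> K\<close> by (auto simp: arc_union_def)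
        then have "y \<in> arc_interior (\<gamma> h)" using yV verts[of h] HE by (auto simp: arc_interior_def)
        moreover have "arc_interior (\<gamma> h) \<inter> arc_interior (\<gamma> e) = {}"
        proof -
          have "e \<noteq> h" using h(1) e(2) by blast
          then show ?thesis using h(1) e(1) by (simp add: uncrossed_edges_def)
        qed
        ultimately show False using y by blast
      qed
      then show ?thesis by blast
    qed
    then have sub: "arc_interior (\<gamma> e) \<subseteq> - K" by blast
    have "connected (arc_interior (\<gamma> e))"
      unfolding int by (rule connected_continuous_image) (auto intro: continuous_on_subset[OF cont])
    then obtain f where f: "f \<in> components (- K)" "arc_interior (\<gamma> e) \<subseteq> f"
      using exists_component_superset[OF sub Compl_compact_nonempty[OF compact_arc_union[OF plane]]] by blast
    have "\<gamma> e ` closure {0<..<1} \<subseteq> closure f"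
      by (rule image_closure_subset) (use cont f(2) closure_subset int in auto)
    then have "x \<subseteq> closure f" by (auto simp: x pathstart_def pathfinish_def)
    then show "\<exists>f\<in>components (- K). x \<subseteq> closure f" using f by blast
  qed
  then show ?thesis using card_image[OF inj_ends] card_image[OF inj] by simp
qed

theorem theorem5:
  fixes V :: "'a set" and E :: "'a set set" and n m :: nat
  assumes "simple_graph V E" and "connected_graph V E"
    and "card V = n" and "card E = m" and "n \<ge> 3"
  shows "real (max_uncrossed V E) \<le>
    3 * real n - 6 - sqrt (2 * real m) + sqrt (6 * (real n - 2))"
proof -
  let ?B = "3 * real n - 6 - sqrt (2 * real m) + sqrt (6 * (real n - 2))"
  let ?X = "{card (uncrossed_edges E \<gamma>) | p \<gamma>. drawing V E p \<gamma>}"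
  have bound: "real h \<le> ?B" if "h \<in> ?X" for h
    using that drawing_uncrossed_bound[OF assms(1)] assms(3-5) by force
  have "sqrt (2 * real m) \<le> real n"
    unfolding assms(3,4)[symmetric]
    by (rule sqrt_twice_card_pairs_le) (use assms(1) in \<open>auto simp: simple_graph_def\<close>)
  moreover have "sqrt (6 * (real n - 2)) \<ge> 0" using assms(5) by simp
  \<comment> \<open>\<open>?B\<close> is at least 3n - 6 - n, and n >= 3.\<close>
  ultimately have B0: "?B \<ge> 0" using assms(5) by simp
  show ?thesis
  proof (cases "?X = {}")
    case True
    \<comment> \<open>The supremum of the empty set of naturals is 0.\<close>
    then show ?thesis unfolding max_uncrossed_def using B0 by (simp add: Sup_nat_def)
  next
    case False
    \<comment> \<open>The supremum is taken in the naturals, so the real bound is first rounded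
      down.\<close>
    have "Sup ?X \<le> nat \<lfloor>?B\<rfloor>"
      using False bound by (intro cSup_least) (auto simp: le_nat_floor)
    then show ?thesis unfolding max_uncrossed_def using B0 by (simp add: le_nat_iff le_floor_iff)
  qed
qed

end
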